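(* Let $(A(n))_{n\in\mathbb{Z}}$ be a sequence of i.i.d. random matrices with values in $(\mathbb{R}\cup\{-\infty\})^{d\times d}$ such that the positive part of $\max_{ij}A_{ij}(0)$ is integrable, $A(0)$ almost surely has at least one finite entry on each row, and $\mathcal{G}(A)$ is strongly connected. Let $y(n,0)=A(-1)\cdots A(-n)\,0$ (max-plus product, applied to the zero vector). Then $$\forall i\in\{1,\dots,d\},\quad \lim_n\frac1n y_i(n,0)=\gamma(A)\quad\text{a.s.}$$
   Context: Max-plus conventions: for matrices and vectors with entries in $\mathbb{R}\cup\{-\infty\}$, products are max-plus products: $(AB)_{ij}=\max_k(A_{ik}+B_{kj})$ and $(Ax)_i=\max_j(A_{ij}+x_j)$. "Finite" means $\neq-\infty$. $0$ denotes also the vector with all coordinates equal to $0$. Limits are taken in $\mathbb{R}\cup\{-\infty\}$. $\mathcal{G}(A)$ is the directed graph with nodes $1,\dots,d$ and arcs the pairs $(i,j)$ such that $\mathbb{P}(A_{ij}(0)\neq-\infty)>0$. Maximal Lyapunov exponent: if $(A(n))$ is a stationary ergodic sequence of random matrices with entries in $\mathbb{R}\cup\{-\infty\}$ such that the positive part of $\max_{ij}A_{ij}(0)$ is integrable, then by Kingman's theorem $\frac1n\max_{ij}(A(n-1)\cdots A(0))_{ij}$ and $\frac1n\max_{ij}(A(-1)\cdots A(-n))_{ij}$ converge almost surely to the same constant $\gamma(A)\in\mathbb{R}\cup\{-\infty\}$, called the maximal Lyapunov exponent. *)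

theory Defs
  imports "HOL-Probability.Probability" "Graph_Theory.Digraph_Component"
begin

text \<open>
  The max-plus semiring, the reals with \<open>-\<infinity>\<close> adjoined, is the set of
  extended reals different from \<open>\<infinity>\<close>. Its multiplication is \<open>+\<close>.
\<close>

definition mp_mult :: "ereal^'m^'n \<Rightarrow> ereal^'k^'m \<Rightarrow> ereal^'k^'n" where
  "mp_mult A B = (\<chi> i j. MAX k. A $ i $ k + B $ k $ j)"

definition mp_mult_vec :: "ereal^'m^'n \<Rightarrow> ereal^'m \<Rightarrow> ereal^'n" where
  "mp_mult_vec A x = (\<chi> i. MAX j. A $ i $ j + x $ j)"

definition mp_id :: "ereal^'n^'n" where
  "mp_id = (\<chi> i j. if i = j then 0 else -\<infinity>)"

definition mp_entry_max :: "ereal^'m^'n \<Rightarrow> ereal" where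
  "mp_entry_max A = (MAX i. MAX j. A $ i $ j)"

text \<open>The product \<open>A(n-1) \<cdots> A(0)\<close>.\<close>

primrec mp_forward :: "(int \<Rightarrow> ereal^'n^'n) \<Rightarrow> nat \<Rightarrow> ereal^'n^'n" where
  "mp_forward A 0 = mp_id"
| "mp_forward A (Suc n) = mp_mult (A (int n)) (mp_forward A n)"

text \<open>The product \<open>A(-1) \<cdots> A(-n)\<close>.\<close>

primrec mp_backward :: "(int \<Rightarrow> ereal^'n^'n) \<Rightarrow> nat \<Rightarrow> ereal^'n^'n" where
  "mp_backward A 0 = mp_id"
| "mp_backward A (Suc n) = mp_mult (mp_backward A n) (A (- int (Suc n)))"

definition mp_y :: "(int \<Rightarrow> ereal^'n^'n) \<Rightarrow> nat \<Rightarrow> ereal^'n \<Rightarrow> ereal^'n" where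
  "mp_y A n x = mp_mult_vec (mp_backward A n) x"

text \<open>
  The maximal Lyapunov exponent is the common almost sure limit given by
  Kingman's theorem. It is unique whenever it exists, because limits are unique
  and a probability space is not a null set.
\<close>

definition max_lyapunov_exponent ::
    "'w measure \<Rightarrow> (int \<Rightarrow> 'w \<Rightarrow> ereal^'n^'n) \<Rightarrow> ereal" where
  "max_lyapunov_exponent M A = (THE \<gamma>. \<gamma> \<noteq> \<infinity> \<and>
     (AE \<omega> in M. (\<lambda>n. ereal (1 / real n) * mp_entry_max (mp_forward (\<lambda>k. A k \<omega>) n))
                  \<longlonglongrightarrow> \<gamma>) \<and>
     (AE \<omega> in M. (\<lambda>n. ereal (1 / real n) * mp_entry_max (mp_backward (\<lambda>k. A k \<omega>) n))
                  \<longlonglongrightarrow> \<gamma>))"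

definition mp_graph ::
    "'w measure \<Rightarrow> (int \<Rightarrow> 'w \<Rightarrow> ereal^'n^'n) \<Rightarrow> ('n, 'n \<times> 'n) pre_digraph" where
  "mp_graph M A =
     \<lparr>verts = UNIV,
      arcs = {(i, j). measure M {\<omega> \<in> space M. A 0 \<omega> $ i $ j \<noteq> -\<infinity>} > 0},
      tail = fst, head = snd\<rparr>"

definition iid_random_matrices ::
    "'w measure \<Rightarrow> (int \<Rightarrow> 'w \<Rightarrow> ereal^'n^'n) \<Rightarrow> bool" where
  "iid_random_matrices M A \<longleftrightarrow>
     prob_space.indep_vars M (\<lambda>_. borel) A UNIV \<and>
     (\<forall>n. distr M borel (A n) = distr M borel (A 0))"

end

theory Submission
  imports Defs
begin

text \<open>
  Read the factors as \<open>w k = A(-1-k)\<close>, \<open>k \<ge> 0\<close>. Then \<open>y\<^sub>i(n,0)\<close> is the largest weight of a path of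
  length \<open>n\<close> that starts in \<open>i\<close>, where step \<open>k\<close> from \<open>a\<close> to \<open>b\<close> weighs \<open>w k $ a $ b\<close>, and the largest
  entry of the product is \<open>max\<^sub>i y\<^sub>i(n,0)\<close>. Write \<open>L\<^sub>i\<close> for the lower limit of \<open>y\<^sub>i(n,0)/n\<close>. Three
  observations give the theorem; the existence of the Lyapunov exponent, that is the relevant case of
  Kingman's theorem, comes out along the way.

  \<^item> All the \<open>L\<^sub>i\<close> are almost surely equal to one and the same constant. Indeed \<open>L\<^sub>i\<close> is at least \<open>L\<^sub>j\<close> of
    the shifted sequence whenever the first arc \<open>(i,j)\<close> is finite. Fix \<open>c\<close> and let \<open>i\<close> maximise the
    probability of \<open>L\<^sub>i \<le> c\<close>. Given the first \<open>t\<close> matrices, some state \<open>j\<close> is reached from \<open>i\<close>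
    because every row has a finite entry, so the conditional probability of \<open>L\<^sub>i \<le> c\<close> is at most
    the probability of \<open>L\<^sub>j \<le> c\<close>, hence at most the unconditional one. An event whose probability
    is never raised by the knowledge of a prefix is independent of all prefixes, hence of itself
    (\<open>zero_one_if_prefix_irrelevant\<close>). If the probability is one, it stays one along every arc, hence
    everywhere by strong connectivity (\<open>backward_dichotomy\<close>).

  \<^item> If every \<open>L\<^sub>i\<close> is below \<open>c\<close>, then even the upper limit of \<open>max\<^sub>i y\<^sub>i(n,0)/n\<close> is at most \<open>c\<close>
    (\<open>AE_limsup_slope_le\<close>). Any path can be cut greedily: whatever state it visits, some \<open>n\<close> has
    \<open>y(n,0) \<le> c n\<close> from there, so the next \<open>n\<close> steps weigh at most \<open>c n\<close>. Only the rare times at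
    which no \<open>n \<le> N\<close> works and the last \<open>N\<close> steps have to be paid for separately, and the maximal
    ergodic inequality shows that their contribution per unit of time is arbitrarily small. The
    length of the pieces may depend on the path, which is why controlling all \<open>y\<^sub>i\<close> at
    once controls their maximum.

  \<^item> Together, \<open>y\<^sub>i(n,0)/n\<close> is squeezed to the common constant, and so is the maximum
    (\<open>convergence_if_dichotomy\<close>). The forward products have the largest entry of a product of the
    same kind with the first \<open>n\<close> factors reversed. As a family with a single index they satisfy the same
    subadditivity and the same zero-one law, so they converge to a constant too, and this is the
    same constant since for each fixed \<open>n\<close> reversal does not change the law.

  The negative parts of the entries may fail to be integrable, so that the expected cost of moving from
  \<open>i\<close> to \<open>j\<close> may be infinite. The lower bound avoids such expectations: the move happens once, and its
  finite random cost disappears after division by \<open>n\<close>.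
\<close>

section \<open>The maximal ergodic inequality\<close>

locale measure_preserving_map = prob_space M for M :: "'a measure" +
  fixes T :: "'a \<Rightarrow> 'a"
  assumes T_measurable [measurable]: "T \<in> measurable M M"
    and distr_T: "distr M M T = M"
begin

lemma funpow_measurable [measurable]: "T ^^ n \<in> measurable M M"
  by (induction n) auto

lemma AE_map: "AE x in M. P (T x)" if "AE x in M. P x"
  using AE_distrD[OF T_measurable, unfolded distr_T] that by blast

lemma AE_funpow: "AE x in M. \<forall>n. P ((T ^^ n) x)" if "AE x in M. P x"
proof -
  have "AE x in M. P ((T ^^ n) x)" for n
  proof (induction n)
    case (Suc n)
    from AE_map[OF this] show ?case
      by (simp add: funpow_swap1)
  qed (use that in simp)
  then show ?thesis
    by (simp add: AE_all_countable)
qed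

lemma integrable_map:
  fixes f :: "'a \<Rightarrow> real"
  assumes "integrable M f"
  shows "integrable M (\<lambda>x. f (T x))"
  using integrable_distr[OF T_measurable, of f] assms by (simp add: distr_T)

lemma integral_map:
  fixes f :: "'a \<Rightarrow> real"
  assumes [measurable]: "f \<in> borel_measurable M"
  shows "(\<integral>x. f (T x) \<partial>M) = (\<integral>x. f x \<partial>M)"
  using integral_distr[OF T_measurable, of f] by (simp add: distr_T)

definition birkhoff_sum :: "('a \<Rightarrow> real) \<Rightarrow> nat \<Rightarrow> 'a \<Rightarrow> real" where
  "birkhoff_sum f n x = (\<Sum>k<n. f ((T ^^ k) x))"

lemma birkhoff_sum_Suc: "birkhoff_sum f (Suc n) x = f x + birkhoff_sum f n (T x)"
  unfolding birkhoff_sum_def by (subst sum.lessThan_Suc_shift) (simp add: funpow_swap1)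

lemma birkhoff_sum_add: "birkhoff_sum f (n + k) x = birkhoff_sum f n x + birkhoff_sum f k ((T ^^ n) x)"
  by (induction n arbitrary: x) (simp_all add: birkhoff_sum_Suc birkhoff_sum_def[of f 0] funpow_swap1)

lemma birkhoff_sum_nonneg: "0 \<le> birkhoff_sum f n x" if "\<And>x. 0 \<le> f x"
  unfolding birkhoff_sum_def by (intro sum_nonneg that)

lemma birkhoff_sum_measurable [measurable]:
  assumes [measurable]: "f \<in> borel_measurable M"
  shows "birkhoff_sum f n \<in> borel_measurable M"
  unfolding birkhoff_sum_def[abs_def] by measurable

text \<open>
  This is the maximum of the sums of length at most \<open>n\<close>, the empty sum included. The recursive form
  is the one in which the maximal ergodic lemma uses it.
\<close>

primrec birkhoff_max :: "('a \<Rightarrow> real) \<Rightarrow> nat \<Rightarrow> 'a \<Rightarrow> real" where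
  "birkhoff_max f 0 x = 0"
| "birkhoff_max f (Suc n) x = max 0 (f x + birkhoff_max f n (T x))"

lemma birkhoff_max_integrable: "integrable M (birkhoff_max f n)" if "integrable M f"
proof (induction n)
  case 0
  then show ?case by (simp add: fun_eq_iff)
next
  case (Suc n)
  have eq: "birkhoff_max f (Suc n) = (\<lambda>x. max 0 (f x + birkhoff_max f n (T x)))"
    by (simp add: fun_eq_iff)
  have "integrable M (\<lambda>x. f x + birkhoff_max f n (T x))"
    using that integrable_map[OF Suc] by (intro Bochner_Integration.integrable_add)
  then show ?case
    unfolding eq by (intro integrable_max) auto
qed

lemma birkhoff_max_nonneg: "0 \<le> birkhoff_max f n x"
  by (cases n) auto

lemma birkhoff_max_mono: "birkhoff_max f n x \<le> birkhoff_max f (Suc n) x"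
proof (induction n arbitrary: x)
  case (Suc n)
  then show ?case
    unfolding birkhoff_max.simps(2)[of f "Suc n"] birkhoff_max.simps(2)[of f n]
    by (intro max.mono add_left_mono order_refl)
qed simp

lemma birkhoff_sum_le_max: "birkhoff_sum f n x \<le> birkhoff_max f n x"
proof (induction n arbitrary: x)
  case 0
  then show ?case by (simp add: birkhoff_sum_def)
next
  case (Suc n)
  from Suc[of "T x"] show ?case
    by (simp add: birkhoff_sum_Suc)
qed

text \<open>
  Garsia's argument: with \<open>B = birkhoff_max f n\<close>, wherever \<open>B > 0\<close> the recursion and monotonicity in
  \<open>n\<close> give \<open>B \<le> f + B \<circ> T\<close>; elsewhere \<open>B = 0 \<le> B \<circ> T\<close>. So the integrand dominates \<open>B - B \<circ> T\<close>, whose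
  integral vanishes by invariance.
\<close>

lemma maximal_ergodic_lemma:
  assumes "integrable M f"
  shows "0 \<le> (\<integral>x. indicator {x\<in>space M. birkhoff_max f n x > 0} x * f x \<partial>M)"
proof (cases n)
  case 0
  then show ?thesis by simp
next
  case (Suc m)
  note [measurable] = borel_measurable_integrable[OF assms]
  let ?B = "birkhoff_max f n"
  note int = birkhoff_max_integrable[OF assms, of n]
  note [measurable] = borel_measurable_integrable[OF int]
  have "0 = (\<integral>x. ?B x \<partial>M) - (\<integral>x. ?B (T x) \<partial>M)"
    by (subst integral_map) auto
  also have "\<dots> = (\<integral>x. ?B x - ?B (T x) \<partial>M)"
    by (intro Bochner_Integration.integral_diff[symmetric] int integrable_map)
  also have "\<dots> \<le> (\<integral>x. indicator {x\<in>space M. ?B x > 0} x * f x \<partial>M)"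
  proof (rule integral_mono)
    show "integrable M (\<lambda>x. ?B x - ?B (T x))"
      by (intro Bochner_Integration.integrable_diff int integrable_map)
    show "integrable M (\<lambda>x. indicator {x\<in>space M. ?B x > 0} x * f x)"
      using integrable_mult_indicator[OF _ assms, of "{x\<in>space M. ?B x > 0}"] by simp
    fix x assume x: "x \<in> space M"
    show "?B x - ?B (T x) \<le> indicator {x\<in>space M. ?B x > 0} x * f x"
    proof (cases "?B x > 0")
      case True
      then have "?B x = f x + birkhoff_max f m (T x)"
        by (simp add: Suc max_def split: if_splits)
      also have "\<dots> \<le> f x + ?B (T x)"
        using birkhoff_max_mono[of f m "T x"] by (simp add: Suc)
      finally show ?thesis using True x by simp
    next
      case False
      then show ?thesis
        using birkhoff_max_nonneg[of f n x] birkhoff_max_nonneg[of f n "T x"] by simp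
    qed
  qed
  finally show ?thesis .
qed

text \<open>
  The maximal ergodic lemma for \<open>f - l\<close>, with \<open>n\<close> tending to infinity.
\<close>

lemma maximal_inequality:
  assumes f: "integrable M f" and nonneg: "\<And>x. 0 \<le> f x" and l: "0 < l"
  shows "measure M {x\<in>space M. \<exists>n. birkhoff_sum f n x > l * real n} \<le> (\<integral>x. f x \<partial>M) / l"
proof -
  note [measurable] = borel_measurable_integrable[OF f]
  define g where "g x = f x - l" for x
  have g: "integrable M g" unfolding g_def using f by simp
  note bmax = birkhoff_max_integrable[OF g]
  note [measurable] = borel_measurable_integrable[OF bmax]
  define E where "E n = {x\<in>space M. birkhoff_max g n x > 0}" for n
  have E[measurable]: "E n \<in> sets M" for n unfolding E_def by measurable
  have bound: "measure M (E n) \<le> (\<integral>x. f x \<partial>M) / l" for n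
  proof -
    have if': "integrable M (\<lambda>x. indicator (E n) x * f x)"
      using integrable_mult_indicator[OF E f] by simp
    have "0 \<le> (\<integral>x. indicator (E n) x * g x \<partial>M)"
      using maximal_ergodic_lemma[OF g, of n] by (simp add: E_def)
    also have "\<dots> = (\<integral>x. indicator (E n) x * f x - l * indicator (E n) x \<partial>M)"
      by (simp add: g_def algebra_simps)
    also have "\<dots> = (\<integral>x. indicator (E n) x * f x \<partial>M) - (\<integral>x. l * indicator (E n) x \<partial>M)"
      by (intro Bochner_Integration.integral_diff if' integrable_mult_right)
         (simp add: integrable_indicator_iff emeasure_eq_measure)
    also have "\<dots> \<le> (\<integral>x. f x \<partial>M) - l * measure M (E n)"
    proof -
      have "(\<integral>x. indicator (E n) x * f x \<partial>M) \<le> (\<integral>x. f x \<partial>M)"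
        by (intro integral_mono if' f) (auto simp: indicator_def nonneg)
      then show ?thesis by simp
    qed
    finally show ?thesis using l by (simp add: field_simps)
  qed
  have inc: "incseq E"
    unfolding E_def by (intro incseq_SucI)
      (auto simp del: birkhoff_max.simps intro: less_le_trans[OF _ birkhoff_max_mono])
  have lim: "(\<lambda>n. measure M (E n)) \<longlonglongrightarrow> measure M (\<Union>n. E n)"
    by (intro finite_Lim_measure_incseq inc) auto
  have sub: "{x\<in>space M. \<exists>n. birkhoff_sum f n x > l * real n} \<subseteq> (\<Union>n. E n)"
  proof safe
    fix x n assume x: "x \<in> space M" and n: "birkhoff_sum f n x > l * real n"
    have "birkhoff_sum g n x = birkhoff_sum f n x - l * real n"
      by (simp add: birkhoff_sum_def g_def sum_subtractf)
    then have "birkhoff_max g n x > 0"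
      using n birkhoff_sum_le_max[of g n x] by linarith
    then show "x \<in> (\<Union>n. E n)" using x by (auto simp: E_def)
  qed
  have "measure M {x\<in>space M. \<exists>n. birkhoff_sum f n x > l * real n} \<le> measure M (\<Union>n. E n)"
    by (intro finite_measure_mono sub) auto
  also have "\<dots> \<le> (\<integral>x. f x \<partial>M) / l"
    by (rule LIMSEQ_le_const2[OF lim]) (use bound in auto)
  finally show ?thesis .
qed

end

section \<open>Rates of growth\<close>

definition slope :: "(nat \<Rightarrow> ereal) \<Rightarrow> nat \<Rightarrow> ereal" where
  "slope a n = ereal (1 / real n) * a n"

lemma slope_le_iff: "slope a n \<le> ereal c \<longleftrightarrow> a n \<le> ereal (c * real n)" if "n > 0"
  using that by (cases "a n") (auto simp: slope_def field_simps)

lemma le_slope_iff: "ereal c \<le> slope a n \<longleftrightarrow> ereal (c * real n) \<le> a n" if "n > 0"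
  using that by (cases "a n") (auto simp: slope_def field_simps)

lemma slope_measurable [measurable]:
  assumes [measurable]: "\<And>n. Z n \<in> borel_measurable M"
  shows "(\<lambda>x. slope (\<lambda>n. Z n x) n) \<in> borel_measurable M"
  unfolding slope_def by measurable

lemma slope_mono: "slope a n \<le> slope b n" if "a n \<le> b n"
  unfolding slope_def by (intro ereal_mult_left_mono that) auto

lemma limsup_slope_le:
  assumes "\<And>n. a n \<le> ereal (c * real n + C)"
  shows "limsup (slope a) \<le> ereal c"
proof -
  have "(\<lambda>n. ereal (c + C / real n)) \<longlonglongrightarrow> ereal (c + 0)"
    unfolding lim_ereal by (intro tendsto_intros real_tendsto_divide_at_top filterlim_real_sequentially)
  moreover have "eventually (\<lambda>n. slope a n \<le> ereal (c + C / real n)) sequentially"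
    using eventually_gt_at_top[of 0]
  proof eventually_elim
    case (elim n)
    then have "(c + C / real n) * real n = c * real n + C"
      by (simp add: distrib_right)
    then show ?case using assms[of n] elim by (subst slope_le_iff) auto
  qed
  ultimately have "limsup (slope a) \<le> limsup (\<lambda>n. ereal (c + C / real n))"
    by (intro Limsup_mono)
  also have "\<dots> = ereal c"
    using \<open>(\<lambda>n. ereal (c + C / real n)) \<longlonglongrightarrow> ereal (c + 0)\<close> by (intro lim_imp_Limsup) auto
  finally show ?thesis .
qed

text \<open>
  Additive constants and shifts of the time index disappear in the rate of growth. Starting both
  sequences at arbitrary offsets lets the lemma serve for delays on either side.
\<close>

lemma liminf_slope_shift_le:
  assumes le: "\<And>n. ereal C + b (t + n) \<le> a (s + n)"
  shows "liminf (slope b) \<le> liminf (slope a)"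
  unfolding le_Liminf_iff
proof (intro allI impI)
  fix y :: ereal assume "y < liminf (slope b)"
  then obtain q where q: "y < ereal q" "ereal q < liminf (slope b)"
    using ereal_dense2 by blast
  then obtain r where r: "ereal q < ereal r" "ereal r < liminf (slope b)"
    using ereal_dense2 by blast
  have "eventually (\<lambda>n. ereal r < slope b n) sequentially"
    using r(2) less_LiminfD by blast
  then have "eventually (\<lambda>n. ereal r < slope b (n + t)) sequentially"
    by (simp only: eventually_sequentially_seg[of "\<lambda>n. ereal r < slope b n" t])
  moreover have "eventually (\<lambda>n. real n * (r - q) > q * real s - C - r * real t) sequentially"
  proof -
    have "filterlim (\<lambda>n. real n * (r - q)) at_top sequentially"
      using r(1) filterlim_tendsto_pos_mult_at_top[OF tendsto_const _ filterlim_real_sequentially, of "r - q"]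
      by (simp add: mult.commute)
    then show ?thesis
      by (simp add: filterlim_at_top_dense)
  qed
  ultimately have "eventually (\<lambda>n. y < slope a (n + s)) sequentially"
    using eventually_gt_at_top[of 0]
  proof eventually_elim
    case (elim n)
    have "ereal (r * real (t + n)) \<le> b (t + n)"
      using elim by (subst le_slope_iff[symmetric]) (auto simp: add.commute)
    moreover have "q * real (n + s) \<le> C + r * real (t + n)"
      using elim by (simp add: algebra_simps)
    then have "ereal (q * real (n + s)) \<le> ereal C + ereal (r * real (t + n))"
      by simp
    ultimately have "ereal (q * real (n + s)) \<le> ereal C + b (t + n)"
      by (meson add_left_mono order_trans)
    also have "\<dots> \<le> a (n + s)"
      using le[of n] by (simp add: add.commute)
    finally have "ereal q \<le> slope a (n + s)"
      using elim by (subst le_slope_iff) auto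
    with q(1) show ?case by (rule less_le_trans)
  qed
  then show "eventually (\<lambda>n. y < slope a n) sequentially"
    by (simp only: eventually_sequentially_seg[of "\<lambda>n. y < slope a n" s])
qed

lemma ereal_le_of_rat_above:
  fixes x y :: ereal
  assumes "\<And>q. y < ereal (real_of_rat q) \<Longrightarrow> x \<le> ereal (real_of_rat q)"
  shows "x \<le> y"
proof (rule ccontr)
  assume "\<not> x \<le> y"
  then have "y < x" by simp
  then obtain q where "y < ereal (real_of_rat q)" "ereal (real_of_rat q) < x"
    using ereal_dense3 by blast
  with assms[of q] show False by simp
qed

lemma ereal_ge_of_rat_below:
  fixes x y :: ereal
  assumes "\<And>q. ereal (real_of_rat q) < x \<Longrightarrow> ereal (real_of_rat q) \<le> y"
  shows "x \<le> y"
proof (rule ccontr)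
  assume "\<not> x \<le> y"
  then have "y < x" by simp
  then obtain q where "y < ereal (real_of_rat q)" "ereal (real_of_rat q) < x"
    using ereal_dense3 by blast
  with assms[of q] show False by simp
qed

section \<open>Families of subadditive processes\<close>

text \<open>
  The abstract form of the vectors \<open>y(n,0)\<close>. For a one-point index type this is the setting of
  Kingman's subadditive theorem. For larger index types the right-hand side
  has a maximum because the state in which the first \<open>n\<close> steps end is not controlled.
\<close>

locale subadditive_family = measure_preserving_map M T for M :: "'a measure" and T +
  fixes Y :: "'i::finite \<Rightarrow> nat \<Rightarrow> 'a \<Rightarrow> ereal" and h :: "'a \<Rightarrow> real"
  assumes Y_measurable [measurable]: "\<And>i n. Y i n \<in> borel_measurable M"
    and Y_0: "\<And>i x. Y i 0 x = 0"
    and subadditive: "\<And>i n k x. Y i (n + k) x \<le> Y i n x + (MAX j. Y j k ((T ^^ n) x))"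
    and h_integrable: "integrable M h"
    and h_nonneg: "\<And>x. 0 \<le> h x"
    and Y_1: "AE x in M. \<forall>i. Y i 1 x \<le> ereal (h x)"
begin

definition Y_max :: "nat \<Rightarrow> 'a \<Rightarrow> ereal" where
  "Y_max n x = (MAX j. Y j n x)"

lemma Y_le_max: "Y i n x \<le> Y_max n x"
  unfolding Y_max_def by (rule Max_ge) auto

lemma Y_max_le_iff: "Y_max n x \<le> c \<longleftrightarrow> (\<forall>i. Y i n x \<le> c)"
  unfolding Y_max_def by (subst Max_le_iff) auto

lemma Y_max_0: "Y_max 0 x = 0"
  unfolding Y_max_def by (simp add: Y_0)

lemma subadditive_max: "Y i (n + k) x \<le> Y i n x + Y_max k ((T ^^ n) x)"
  using subadditive[of i n k x] unfolding Y_max_def .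

lemma Y_max_le_sum:
  assumes "\<And>t i. Y i 1 ((T ^^ t) x) \<le> ereal (c + g ((T ^^ t) x))"
  shows "Y_max n x \<le> ereal (c * real n + birkhoff_sum g n x)"
  using assms
proof (induction n arbitrary: x)
  case 0
  then show ?case by (simp add: Y_max_0 birkhoff_sum_def)
next
  case (Suc n)
  have "Y_max n (T x) \<le> ereal (c * real n + birkhoff_sum g n (T x))"
    using Suc.prems[of _ "Suc t" for t] by (intro Suc.IH) (simp add: funpow_swap1)
  moreover have "Y i 1 x \<le> ereal (c + g x)" for i
    using Suc.prems[of i 0] by simp
  ultimately have "Y i 1 x + Y_max n (T x) \<le> ereal (c + g x) + ereal (c * real n + birkhoff_sum g n (T x))" for i
    by (intro add_mono)
  then have "Y i (1 + n) x \<le> ereal (c + g x) + ereal (c * real n + birkhoff_sum g n (T x))" for i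
    using subadditive_max[of i 1 n x] by (simp add: order_trans)
  then show ?case
    by (simp add: Y_max_le_iff birkhoff_sum_Suc algebra_simps)
qed

text \<open>
  At these points the greedy decomposition of some path finds no piece of length at most \<open>N\<close> to cut
  off.
\<close>

definition stuck :: "real \<Rightarrow> nat \<Rightarrow> 'a set" where
  "stuck c N = {x. \<exists>i. \<forall>n\<in>{1..N}. ereal (c * real n) < Y i n x}"

text \<open>
  The price of a time step in the tiling of a path. The first summand pays for a step from a stuck
  point. The second one pays for the incomplete piece at the end of the path, together with a constant
  \<open>N\<close> for each of its at most \<open>N\<close> steps, because \<open>g \<le> N + max 0 (g - N)\<close>. Using \<open>N\<close> both as horizon and
  as truncation level leaves a single limit to take.
\<close>

definition excess :: "real \<Rightarrow> ('a \<Rightarrow> real) \<Rightarrow> nat \<Rightarrow> 'a \<Rightarrow> real" where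
  "excess c g N x = indicator (stuck c N) x * g x + max 0 (g x - real N)"

text \<open>
  The greedy decomposition of a path, as an induction on its length \<open>K\<close>. If the current point is not
  stuck, cut off a piece of at most \<open>N\<close> steps whose average is at most \<open>c\<close>; if it is stuck, cut off
  a single step. The piece may depend on the index \<open>i\<close>, since the induction hypothesis
  bounds the maximum over all indices of what remains. Once at most \<open>N\<close> steps remain, they
  are estimated one by one.
\<close>

lemma Y_max_le_tiling:
  assumes g: "\<And>x. 0 \<le> g x"
    and Y: "\<And>t i. Y i 1 ((T ^^ t) x) \<le> ereal (c + g ((T ^^ t) x))"
    and N: "N \<ge> 1"
  shows "Y_max K x \<le> ereal (c * real K + birkhoff_sum (excess c g N) K x + real N * real N)"
  using Y
proof (induction K arbitrary: x rule: less_induct)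
  case (less K)
  let ?f = "excess c g N"
  have f: "0 \<le> ?f y" for y
    by (auto simp: excess_def g)
  have gf: "g y \<le> ?f y + real N" for y
    using g[of y] by (auto simp: excess_def indicator_def max_def)
  show ?case
  proof (cases "K \<le> N")
    case True
    have "birkhoff_sum g K x \<le> birkhoff_sum (\<lambda>y. ?f y + real N) K x"
      unfolding birkhoff_sum_def by (intro sum_mono gf)
    also have "\<dots> = birkhoff_sum ?f K x + real K * real N"
      by (simp add: birkhoff_sum_def sum.distrib)
    also have "\<dots> \<le> birkhoff_sum ?f K x + real N * real N"
      using True by (simp add: mult_right_mono)
    finally have "ereal (c * real K + birkhoff_sum g K x) \<le>
      ereal (c * real K + birkhoff_sum ?f K x + real N * real N)" by simp
    with Y_max_le_sum[of x c g K, OF less.prems] show ?thesis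
      by (rule order_trans)
  next
    case False
    \<comment> \<open>It suffices to find a first piece of length \<open>n\<close> on which the bound holds.\<close>
    have piece: "Y i K x \<le> ereal (c * real K + birkhoff_sum ?f K x + real N * real N)"
      if n: "1 \<le> n" "n \<le> K" and Yn: "Y i n x \<le> ereal (c * real n + birkhoff_sum ?f n x)" for n i
    proof -
      have "Y_max (K - n) ((T ^^ n) x) \<le>
          ereal (c * real (K - n) + birkhoff_sum ?f (K - n) ((T ^^ n) x) + real N * real N)"
        using n less.prems[of i' "t + n" for i' t]
        by (intro less.IH) (auto simp: funpow_add)
      then have "Y i n x + Y_max (K - n) ((T ^^ n) x) \<le> ereal (c * real n + birkhoff_sum ?f n x) +
          ereal (c * real (K - n) + birkhoff_sum ?f (K - n) ((T ^^ n) x) + real N * real N)"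
        by (intro add_mono Yn)
      also have "\<dots> = ereal (c * real K + birkhoff_sum ?f K x + real N * real N)"
        using n birkhoff_sum_add[of ?f n "K - n" x] by (simp add: of_nat_diff algebra_simps)
      finally show ?thesis
        using subadditive_max[of i n "K - n" x] n by simp
    qed
    have "Y i K x \<le> ereal (c * real K + birkhoff_sum ?f K x + real N * real N)" for i
    proof (cases "x \<in> stuck c N")
      case True
      then have "g x \<le> ?f x"
        by (simp add: excess_def)
      then have "ereal (c + g x) \<le> ereal (c * real 1 + birkhoff_sum ?f 1 x)"
        by (simp add: birkhoff_sum_def)
      then have "Y i 1 x \<le> ereal (c * real 1 + birkhoff_sum ?f 1 x)"
        using less.prems[of i 0] by (auto intro: order_trans)
      then show ?thesis
        using False N by (intro piece[of 1]) auto
    next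
      case False': False
      then have "\<exists>n\<in>{1..N}. Y i n x \<le> ereal (c * real n)"
        by (auto simp: stuck_def not_less)
      then obtain n where n: "1 \<le> n" "n \<le> N" "Y i n x \<le> ereal (c * real n)"
        by auto
      have "ereal (c * real n) \<le> ereal (c * real n + birkhoff_sum ?f n x)"
        using birkhoff_sum_nonneg[of ?f n x] f by simp
      with n(3) have "Y i n x \<le> ereal (c * real n + birkhoff_sum ?f n x)"
        by (rule order_trans)
      then show ?thesis
        using n False by (intro piece[of n]) auto
    qed
    then show ?thesis
      by (simp add: Y_max_le_iff)
  qed
qed

lemma stuck_measurable [measurable]: "Measurable.pred M (\<lambda>x. x \<in> stuck c N)"
  unfolding stuck_def by measurable

lemma excess_measurable [measurable]:
  assumes [measurable]: "g \<in> borel_measurable M"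
  shows "excess c g N \<in> borel_measurable M"
proof -
  have "excess c g N = (\<lambda>x. (if x \<in> stuck c N then g x else 0) + max 0 (g x - real N))"
    by (auto simp: excess_def fun_eq_iff)
  then show ?thesis by simp
qed

text \<open>
  By dominated convergence: if the averages dip to \<open>c\<close> for every index, then almost no point is stuck
  for all \<open>N\<close>.
\<close>

lemma integral_excess_tendsto_0:
  assumes g: "integrable M g" "\<And>x. 0 \<le> g x"
    and dips: "AE x in M. \<forall>i. \<exists>n\<ge>1. Y i n x \<le> ereal (c * real n)"
  shows "integrable M (excess c g N)"
    and "(\<lambda>N. \<integral>x. excess c g N x \<partial>M) \<longlonglongrightarrow> 0"
proof -
  note [measurable] = borel_measurable_integrable[OF g(1)]
  have bound: "norm (excess c g N x) \<le> 2 * g x" for N x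
    using g(2)[of x] by (auto simp: excess_def indicator_def)
  have g2: "integrable M (\<lambda>x. 2 * g x)"
    using g(1) by simp
  show "integrable M (excess c g N)"
    using bound g(2) by (intro Bochner_Integration.integrable_bound[OF g2]) auto
  have "(\<lambda>N. \<integral>x. excess c g N x \<partial>M) \<longlonglongrightarrow> (\<integral>x. 0 \<partial>M)"
  proof (rule integral_dominated_convergence[where w = "\<lambda>x. 2 * g x"])
    show "AE x in M. (\<lambda>N. excess c g N x) \<longlonglongrightarrow> 0"
      using dips
    proof eventually_elim
      case (elim x)
      then obtain n where n: "\<And>i. 1 \<le> n i" "\<And>i. Y i (n i) x \<le> ereal (c * real (n i))"
        by metis
      have "eventually (\<lambda>N. N \<ge> Max (range n) \<and> real N \<ge> g x) sequentially"
        using eventually_ge_at_top[of "Max (range n)"] eventually_ge_at_top[of "nat \<lceil>g x\<rceil>"]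
        by eventually_elim linarith
      then have "eventually (\<lambda>N. excess c g N x = 0) sequentially"
      proof eventually_elim
        case (elim N)
        then have "n i \<le> N" for i
          by (meson Max_ge finite finite_imageI order_trans rangeI)
        then have "\<exists>m\<in>{1..N}. Y i m x \<le> ereal (c * real m)" for i
          using n by (intro bexI[of _ "n i"]) auto
        then have "x \<notin> stuck c N"
          unfolding stuck_def by (simp add: not_less)
        with elim show ?case
          by (simp add: excess_def)
      qed
      then show ?case
        by (rule tendsto_eventually)
    qed
  qed (use g2 bound in auto)
  then show "(\<lambda>N. \<integral>x. excess c g N x \<partial>M) \<longlonglongrightarrow> 0"
    by simp
qed

text \<open>
  The heart of the upper bound: one dip of each member of the family to the level \<open>c\<close>, at
  whatever time, forces the rate of growth of the maximum down to \<open>c\<close>. In the tiling bound the only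
  term linear in the length besides \<open>c K\<close> is the sum of the \<open>excess\<close>. By the maximal
  inequality, the probability that it ever exceeds \<open>l K\<close> is at most the integral of the \<open>excess\<close> divided
  by \<open>l\<close>, which is small for large \<open>N\<close>.
\<close>

lemma AE_limsup_slope_le:
  assumes dips: "AE x in M. \<forall>i. \<exists>n\<ge>1. Y i n x \<le> ereal (c * real n)"
  shows "AE x in M. limsup (slope (\<lambda>n. Y_max n x)) \<le> ereal c"
proof -
  \<comment> \<open>This makes \<open>g\<close> nonnegative and gives \<open>h \<le> c + g\<close> for either sign of \<open>c\<close>.\<close>
  define g where "g x = h x + \<bar>c\<bar>" for x
  have g: "integrable M g" "\<And>x. 0 \<le> g x"
    unfolding g_def using h_integrable h_nonneg by (auto simp: add_nonneg_nonneg)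
  note [measurable] = borel_measurable_integrable[OF g(1)]
  note exc = integral_excess_tendsto_0[OF g dips]
  have exc_nonneg: "0 \<le> excess c g N x" for N x
    using g(2) by (auto simp: excess_def)
  have step: "AE x in M. \<forall>t i. Y i 1 ((T ^^ t) x) \<le> ereal (c + g ((T ^^ t) x))"
  proof (rule AE_funpow)
    show "AE x in M. \<forall>i. Y i 1 x \<le> ereal (c + g x)"
      using Y_1
    proof eventually_elim
      case (elim x)
      have "ereal (h x) \<le> ereal (c + g x)"
        by (simp add: g_def)
      with elim show ?case using order_trans by blast
    qed
  qed
  have small: "AE x in M. \<exists>N\<ge>1. \<forall>K. birkhoff_sum (excess c g N) K x \<le> l * real K" if l: "l > 0" for l
  proof -
    define B where "B N = {x\<in>space M. \<exists>K. birkhoff_sum (excess c g N) K x > l * real K}" for N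
    have [measurable]: "B N \<in> sets M" for N
      unfolding B_def by measurable
    have "measure M (\<Inter>N\<in>{1..}. B N) \<le> 0"
    proof (rule LIMSEQ_le_const)
      show "(\<lambda>N. (\<integral>x. excess c g N x \<partial>M) / l) \<longlonglongrightarrow> 0"
        using exc(2) by (rule tendsto_divide_zero)
      have "measure M (\<Inter>N\<in>{1..}. B N) \<le> (\<integral>x. excess c g N x \<partial>M) / l" if "N \<ge> 1" for N
      proof -
        have "measure M (\<Inter>N\<in>{1..}. B N) \<le> measure M (B N)"
          using that by (intro finite_measure_mono) auto
        also have "\<dots> \<le> (\<integral>x. excess c g N x \<partial>M) / l"
          unfolding B_def by (intro maximal_inequality exc exc_nonneg l)
        finally show ?thesis .
      qed
      then show "\<exists>N. \<forall>n\<ge>N. measure M (\<Inter>N\<in>{1..}. B N) \<le> (\<integral>x. excess c g n x \<partial>M) / l"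
        by blast
    qed
    then have "measure M (\<Inter>N\<in>{1..}. B N) = 0"
      using measure_nonneg[of M] by (intro antisym) auto
    then have "AE x in M. x \<notin> (\<Inter>N\<in>{1..}. B N)"
      by (intro AE_not_in) (auto simp: null_sets_def emeasure_eq_measure)
    then show ?thesis
      using AE_space by eventually_elim (auto simp: B_def not_less)
  qed
  have "AE x in M. \<forall>m. \<exists>N\<ge>1. \<forall>K. birkhoff_sum (excess c g N) K x \<le> 1 / real (Suc m) * real K"
    unfolding AE_all_countable by (intro allI small) simp
  then show ?thesis
    using step
  proof eventually_elim
    case (elim x)
    have le: "limsup (slope (\<lambda>n. Y_max n x)) \<le> ereal (c + 1 / real (Suc m))" for m
    proof -
      obtain N where N: "N \<ge> 1" "\<And>K. birkhoff_sum (excess c g N) K x \<le> 1 / real (Suc m) * real K"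
        using elim by blast
      have "Y_max K x \<le> ereal ((c + 1 / real (Suc m)) * real K + real N * real N)" for K
      proof -
        have "Y_max K x \<le> ereal (c * real K + birkhoff_sum (excess c g N) K x + real N * real N)"
          using elim by (intro Y_max_le_tiling g N) auto
        also have "\<dots> \<le> ereal ((c + 1 / real (Suc m)) * real K + real N * real N)"
          using N(2)[of K] by (simp add: distrib_right)
        finally show ?thesis .
      qed
      then show ?thesis
        by (rule limsup_slope_le)
    qed
    show ?case
    proof (rule tendsto_lowerbound)
      have "(\<lambda>m. ereal (c + 1 / real (Suc m))) \<longlonglongrightarrow> ereal (c + 0)"
        unfolding lim_ereal by (intro tendsto_intros LIMSEQ_Suc lim_1_over_n)
      then show "(\<lambda>m. ereal (c + 1 / real (Suc m))) \<longlonglongrightarrow> ereal c" by simp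
    qed (use le in auto)
  qed
qed

text \<open>
  Integrability of \<open>h\<close> excludes growth at an infinite rate: with positive probability the sums of
  \<open>h\<close> stay below \<open>l n\<close> for all \<open>n\<close>, as soon as \<open>l\<close> exceeds the integral of \<open>h\<close>.
\<close>

lemma not_AE_liminf_gt: "\<exists>c::real. \<not> (AE x in M. \<forall>i. ereal c \<le> liminf (slope (\<lambda>n. Y i n x)))"
proof -
  define l where "l = (\<integral>x. h x \<partial>M) + 1"
  have "0 \<le> (\<integral>x. h x \<partial>M)"
    by (intro integral_nonneg_AE) (simp add: h_nonneg)
  then have l: "l > 0" "(\<integral>x. h x \<partial>M) / l < 1"
    unfolding l_def by auto
  note [measurable] = borel_measurable_integrable[OF h_integrable]
  have step: "AE x in M. \<forall>t i. Y i 1 ((T ^^ t) x) \<le> ereal (h ((T ^^ t) x))"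
    by (rule AE_funpow[OF Y_1])
  have "\<not> (AE x in M. \<forall>i. ereal (l + 1) \<le> liminf (slope (\<lambda>n. Y i n x)))"
  proof
    assume "AE x in M. \<forall>i. ereal (l + 1) \<le> liminf (slope (\<lambda>n. Y i n x))"
    then have "AE x in M. \<exists>n. birkhoff_sum h n x > l * real n"
      using step
    proof eventually_elim
      case (elim x)
      show ?case
      proof (rule ccontr)
        assume "\<not> ?case"
        then have *: "birkhoff_sum h n x \<le> l * real n" for n
          by (auto simp: not_less)
        fix i
        have "Y i n x \<le> ereal (l * real n + 0)" for n
          using Y_max_le_sum[of x 0 h n] elim *[of n] Y_le_max[of i n x]
          by (auto intro: order_trans)
        then have "limsup (slope (\<lambda>n. Y i n x)) \<le> ereal l"
          by (rule limsup_slope_le)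
        moreover have "liminf (slope (\<lambda>n. Y i n x)) \<le> limsup (slope (\<lambda>n. Y i n x))"
          by (intro Liminf_le_Limsup) auto
        ultimately have "liminf (slope (\<lambda>n. Y i n x)) \<le> ereal l"
          by (rule order_trans[rotated])
        moreover have "ereal (l + 1) \<le> liminf (slope (\<lambda>n. Y i n x))"
          using elim by blast
        ultimately have "ereal (l + 1) \<le> ereal l"
          by (rule order_trans[rotated])
        then show False by simp
      qed
    qed
    then have "measure M {x\<in>space M. \<exists>n. birkhoff_sum h n x > l * real n} = 1"
      by (intro prob_Collect_eq_1[THEN iffD2]) auto
    with maximal_inequality[OF h_integrable h_nonneg l(1)] l(2) show False
      by simp
  qed
  then show ?thesis by blast
qed

text \<open>
  The hypothesis says that the lower rates are almost surely constant with the same constant for all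
  indices. That constant is the infimum of the levels of the first kind.
\<close>

lemma convergence_if_dichotomy:
  assumes dichotomy: "\<And>c::real. (AE x in M. \<forall>i. liminf (slope (\<lambda>n. Y i n x)) \<le> ereal c) \<or>
      (AE x in M. \<forall>i. ereal c \<le> liminf (slope (\<lambda>n. Y i n x)))"
  shows "\<exists>\<gamma>. \<gamma> \<noteq> \<infinity> \<and> (AE x in M. (\<forall>i. slope (\<lambda>n. Y i n x) \<longlonglongrightarrow> \<gamma>) \<and>
      slope (\<lambda>n. Y_max n x) \<longlonglongrightarrow> \<gamma>)"
proof -
  define U where "U = {c::real. AE x in M. \<forall>i. liminf (slope (\<lambda>n. Y i n x)) \<le> ereal c}"
  define \<gamma> where "\<gamma> = Inf (ereal ` U)"
  obtain c0 where "c0 \<in> U"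
    using not_AE_liminf_gt dichotomy unfolding U_def by blast
  then have "\<gamma> \<le> ereal c0"
    unfolding \<gamma>_def by (intro Inf_lower) auto
  then have fin: "\<gamma> \<noteq> \<infinity>" by auto
  have lower: "AE x in M. \<forall>i. ereal c \<le> liminf (slope (\<lambda>n. Y i n x))" if "ereal c < \<gamma>" for c
  proof -
    have "c \<notin> U"
      using that unfolding \<gamma>_def by (meson Inf_lower imageI not_le)
    then show ?thesis
      using dichotomy[of c] unfolding U_def by auto
  qed
  have upper: "AE x in M. limsup (slope (\<lambda>n. Y_max n x)) \<le> ereal c" if c: "\<gamma> < ereal c" for c
  proof (rule AE_limsup_slope_le)
    obtain c' where c': "c' \<in> U" "c' < c"
      using c unfolding \<gamma>_def by (auto simp: INF_less_iff)
    from c'(1) show "AE x in M. \<forall>i. \<exists>n\<ge>1. Y i n x \<le> ereal (c * real n)"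
      unfolding U_def mem_Collect_eq
    proof eventually_elim
      case (elim x)
      show ?case
      proof (rule allI, rule ccontr)
        fix i assume *: "\<not> (\<exists>n\<ge>1. Y i n x \<le> ereal (c * real n))"
        have "ereal c \<le> liminf (slope (\<lambda>n. Y i n x))"
        proof (rule Liminf_bounded)
          show "\<forall>\<^sub>F n in sequentially. ereal c \<le> slope (\<lambda>n. Y i n x) n"
            using eventually_gt_at_top[of 0]
          proof eventually_elim
            case (elim n)
            then have "\<not> Y i n x \<le> ereal (c * real n)" using * by auto
            then show ?case using elim by (subst le_slope_iff) auto
          qed
        qed
        also have "\<dots> \<le> ereal c'" using elim by blast
        finally show False using c'(2) by simp
      qed
    qed
  qed
  have "AE x in M. \<forall>q. ereal (real_of_rat q) < \<gamma> \<longrightarrow>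
      (\<forall>i. ereal (real_of_rat q) \<le> liminf (slope (\<lambda>n. Y i n x)))"
    unfolding AE_all_countable using lower by auto
  moreover have "AE x in M. \<forall>q. \<gamma> < ereal (real_of_rat q) \<longrightarrow>
      limsup (slope (\<lambda>n. Y_max n x)) \<le> ereal (real_of_rat q)"
    unfolding AE_all_countable using upper by auto
  ultimately have "AE x in M. (\<forall>i. slope (\<lambda>n. Y i n x) \<longlonglongrightarrow> \<gamma>) \<and> slope (\<lambda>n. Y_max n x) \<longlonglongrightarrow> \<gamma>"
  proof eventually_elim
    case (elim x)
    have low: "\<gamma> \<le> liminf (slope (\<lambda>n. Y i n x))" for i
      by (rule ereal_ge_of_rat_below) (use elim(1) in auto)
    have up: "limsup (slope (\<lambda>n. Y_max n x)) \<le> \<gamma>"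
      by (rule ereal_le_of_rat_above) (use elim(2) in auto)
    have mono: "slope (\<lambda>n. Y i n x) n \<le> slope (\<lambda>n. Y_max n x) n" for i n
      by (intro slope_mono Y_le_max)
    have squeeze: "z \<longlonglongrightarrow> \<gamma>" if "\<gamma> \<le> liminf z" "limsup z \<le> \<gamma>" for z
    proof -
      have "liminf z \<le> limsup z"
        by (rule Liminf_le_Limsup) simp
      with that have "liminf z = \<gamma>" "limsup z = \<gamma>"
        by (meson antisym order_trans)+
      then show ?thesis
        by (simp add: tendsto_iff_Liminf_eq_Limsup)
    qed
    have "limsup (slope (\<lambda>n. Y i n x)) \<le> limsup (slope (\<lambda>n. Y_max n x))" for i
      using mono by (intro Limsup_mono) simp
    then have 1: "slope (\<lambda>n. Y i n x) \<longlonglongrightarrow> \<gamma>" for i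
      by (rule squeeze[OF low order_trans[OF _ up]])
    have "liminf (slope (\<lambda>n. Y i n x)) \<le> liminf (slope (\<lambda>n. Y_max n x))" for i
      using mono by (intro Liminf_mono) simp
    then have 2: "slope (\<lambda>n. Y_max n x) \<longlonglongrightarrow> \<gamma>"
      by (rule squeeze[OF order_trans[OF low] up])
    from 1 2 show ?case by blast
  qed
  with fin show ?thesis by blast
qed

end

section \<open>Independent sequences\<close>

definition seq_shift :: "(nat \<Rightarrow> 'a) \<Rightarrow> nat \<Rightarrow> 'a" where
  "seq_shift w = (\<lambda>k. w (Suc k))"

lemma seq_shift_funpow: "(seq_shift ^^ n) w = (\<lambda>k. w (n + k))"
  by (induction n arbitrary: w) (simp_all add: seq_shift_def fun_eq_iff)

lemma seq_shift_comb_seq: "seq_shift (comb_seq (Suc t) w v) = comb_seq t (seq_shift w) v"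
  by (auto simp: seq_shift_def comb_seq_def fun_eq_iff)

text \<open>
  Only the first \<open>n\<close> terms are reversed; keeping the others in place makes this a permutation of the
  indices, so that it preserves the law of an independent identically distributed sequence.
\<close>

definition reverse_prefix :: "nat \<Rightarrow> (nat \<Rightarrow> 'a) \<Rightarrow> nat \<Rightarrow> 'a" where
  "reverse_prefix n w = (\<lambda>k. w (if k < n then n - Suc k else k))"

context sequence_space
begin

lemma distr_reindex_inj:
  fixes f :: "nat \<Rightarrow> nat"
  assumes "inj f"
  shows "(\<lambda>w k. w (f k)) \<in> measurable S S" "distr S S (\<lambda>w k. w (f k)) = S"
proof -
  show "(\<lambda>w k. w (f k)) \<in> measurable S S"
    by (intro measurable_PiM_single') (auto simp: space_PiM PiE_iff)
  show "distr S S (\<lambda>w k. w (f k)) = S"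
    using distr_PiM_reindex[of UNIV "\<lambda>_. M" f UNIV] assms prob_space by (simp add: restrict_UNIV)
qed

lemma measure_preserving_seq_shift: "measure_preserving_map S seq_shift"
proof (intro measure_preserving_map.intro measure_preserving_map_axioms.intro)
  have eq: "seq_shift = (\<lambda>w k. w (Suc k))" by (simp add: seq_shift_def fun_eq_iff)
  show "seq_shift \<in> measurable S S" "distr S S seq_shift = S"
    unfolding eq by (rule distr_reindex_inj, simp)+
qed (rule P.prob_space_axioms)

lemma reverse_prefix_measure_preserving:
  shows reverse_prefix_measurable: "reverse_prefix n \<in> measurable S S"
    and distr_reverse_prefix: "distr S S (reverse_prefix n) = S"
proof -
  have eq: "reverse_prefix n = (\<lambda>w k. w (if k < n then n - Suc k else k))"
    by (simp add: reverse_prefix_def fun_eq_iff)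
  have inj: "inj (\<lambda>k. if k < n then n - Suc k else k)"
    by (rule injI) (auto split: if_splits)
  show "reverse_prefix n \<in> measurable S S" "distr S S (reverse_prefix n) = S"
    unfolding eq using distr_reindex_inj[OF inj] by auto
qed

text \<open>
  Conditioning on a prefix of length \<open>t\<close>: replacing the remainder by an independent copy does not
  change the law of the sequence.
\<close>

lemma emeasure_comb_seq:
  assumes [measurable]: "E \<in> sets S"
  shows "emeasure S E = (\<integral>\<^sup>+w. emeasure S {v\<in>space S. comb_seq t w v \<in> E} \<partial>S)"
proof -
  let ?X = "(\<lambda>(w, v). comb_seq t w v) -` E \<inter> space (S \<Otimes>\<^sub>M S)"
  have m: "(\<lambda>(w, v). comb_seq t w v) \<in> measurable (S \<Otimes>\<^sub>M S) S"
    by (rule measurable_comb_seq)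
  have "emeasure S E = emeasure (distr (S \<Otimes>\<^sub>M S) S (\<lambda>(w, v). comb_seq t w v)) E"
    by (simp only: PiM_comb_seq)
  also have "\<dots> = emeasure (S \<Otimes>\<^sub>M S) ?X"
    by (rule emeasure_distr[OF m]) simp
  also have "\<dots> = (\<integral>\<^sup>+w. emeasure S (Pair w -` ?X) \<partial>S)"
    using m by (intro P.emeasure_pair_measure_alt measurable_sets[OF m]) simp
  also have "\<dots> = (\<integral>\<^sup>+w. emeasure S {v\<in>space S. comb_seq t w v \<in> E} \<partial>S)"
    by (intro nn_integral_cong arg_cong[where f = "emeasure S"]) (auto simp: space_pair_measure)
  finally show ?thesis .
qed

lemma AE_comb_seq:
  assumes "AE w in S. Q w"
  shows "AE w in S. AE v in S. Q (comb_seq t w v)"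
proof -
  interpret pair_sigma_finite S S
    by (intro pair_sigma_finite.intro P.sigma_finite_measure_axioms)
  have "AE x in S \<Otimes>\<^sub>M S. Q ((\<lambda>(w, v). comb_seq t w v) x)"
    using assms by (intro AE_distrD[OF measurable_comb_seq]) (simp only: PiM_comb_seq)
  then show ?thesis
    using AE_pair[of "\<lambda>x. Q (case_prod (comb_seq t) x)"] by simp
qed

text \<open>
  If no prefix raises the probability of \<open>E\<close>, then no prefix lowers it either, because the conditional
  probabilities average to the probability of \<open>E\<close>. Hence \<open>E\<close> is independent of every cylinder,
  so conditioning on \<open>E\<close> leaves the product measure unchanged. But \<open>E\<close> is certain under the conditioned measure.
\<close>

lemma zero_one_if_prefix_irrelevant:
  assumes E[measurable]: "E \<in> sets S"
    and cond: "\<And>t. AE w in S. measure S {v\<in>space S. comb_seq t w v \<in> E} \<le> measure S E"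
  shows "measure S E = 0 \<or> measure S E = 1"
proof (rule disjCI)
  assume "measure S E \<noteq> 1"
  have le: "measure S (E \<inter> G) \<le> measure S E * measure S G"
    if G[measurable]: "G \<in> sets S"
      and dep: "\<And>w v. w \<in> space S \<Longrightarrow> v \<in> space S \<Longrightarrow> comb_seq t w v \<in> G \<longleftrightarrow> w \<in> G" for G t
  proof -
    have "emeasure S (E \<inter> G) = (\<integral>\<^sup>+w. emeasure S {v\<in>space S. comb_seq t w v \<in> E \<inter> G} \<partial>S)"
      by (rule emeasure_comb_seq) simp
    also have "\<dots> = (\<integral>\<^sup>+w. indicator G w * emeasure S {v\<in>space S. comb_seq t w v \<in> E} \<partial>S)"
    proof (rule nn_integral_cong)
      fix w assume w: "w \<in> space S"
      show "emeasure S {v\<in>space S. comb_seq t w v \<in> E \<inter> G} =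
          indicator G w * emeasure S {v\<in>space S. comb_seq t w v \<in> E}"
        using dep[OF w] by (cases "w \<in> G") (auto cong: conj_cong)
    qed
    also have "\<dots> \<le> (\<integral>\<^sup>+w. emeasure S E * indicator G w \<partial>S)"
    proof (rule nn_integral_mono_AE)
      show "AE w in S. indicator G w * emeasure S {v\<in>space S. comb_seq t w v \<in> E} \<le> emeasure S E * indicator G w"
        using cond[of t]
        by eventually_elim (auto simp: P.emeasure_eq_measure indicator_def)
    qed
    also have "\<dots> = emeasure S E * emeasure S G"
      by (simp add: nn_integral_cmult)
    finally show ?thesis
      by (simp add: P.emeasure_eq_measure ennreal_mult''[symmetric])
  qed
  \<comment> \<open>The complement of \<open>G\<close> also depends on the prefix only, which yields the opposite inequality.\<close>
  have eq: "measure S (E \<inter> G) = measure S E * measure S G"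
    if G[measurable]: "G \<in> sets S"
      and dep: "\<And>w v. w \<in> space S \<Longrightarrow> v \<in> space S \<Longrightarrow> comb_seq t w v \<in> G \<longleftrightarrow> w \<in> G" for G t
  proof -
    have comb: "comb_seq t w v \<in> space S" if "w \<in> space S" "v \<in> space S" for w v
      using that by (auto simp: space_PiM PiE_iff comb_seq_def)
    have "measure S (E \<inter> (space S - G)) \<le> measure S E * measure S (space S - G)"
    proof (rule le)
      show "space S - G \<in> sets S" by simp
      show "comb_seq t w v \<in> space S - G \<longleftrightarrow> w \<in> space S - G"
        if "w \<in> space S" "v \<in> space S" for w v
        using dep[OF that] comb[OF that] that by simp
    qed
    also have "\<dots> = measure S E - measure S E * measure S G"
      by (simp add: P.prob_compl algebra_simps)
    finally have "measure S E * measure S G \<le> measure S E - measure S (E \<inter> (space S - G))"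
      by simp
    also have "\<dots> = measure S (E \<inter> G)"
    proof -
      have "E \<inter> (space S - G) = E - E \<inter> G" using sets.sets_into_space[OF E] by auto
      then show ?thesis using P.finite_measure_Diff[of E "E \<inter> G"] by simp
    qed
    finally show ?thesis using le[OF G dep] by (intro antisym) auto
  qed
  show "measure S E = 0"
  proof (rule ccontr)
    assume pos: "measure S E \<noteq> 0"
    then have pos': "emeasure S E \<noteq> 0"
      by (simp add: P.emeasure_eq_measure measure_nonneg)
    interpret U: prob_space "uniform_measure S E"
      using pos' by (intro prob_space_uniform_measure) auto
    have "uniform_measure S E = S"
    proof (rule measure_eqI_PiM_infinite)
      fix A and J :: "nat set" assume J: "finite J" and A: "\<And>i. i \<in> J \<Longrightarrow> A i \<in> sets M"
      let ?G = "prod_emb UNIV (\<lambda>_. M) J (Pi\<^sub>E J A)"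
      obtain t where t: "J \<subseteq> {..<t}"
        using J finite_nat_iff_bounded by auto
      have G: "?G \<in> sets S"
        using J A by (intro sets_PiM_I) auto
      have mem: "w \<in> ?G \<longleftrightarrow> (\<forall>j\<in>J. w j \<in> A j)" if "w \<in> space S" for w
        using that by (simp add: prod_emb_def space_PiM Pi_iff)
      have "comb_seq t w v \<in> ?G \<longleftrightarrow> w \<in> ?G" if "w \<in> space S" "v \<in> space S" for w v
      proof -
        have "comb_seq t w v \<in> space S"
          using that by (auto simp: space_PiM PiE_iff comb_seq_def)
        moreover have "comb_seq t w v j = w j" if "j \<in> J" for j
          using t that by (auto intro: comb_seq_less)
        ultimately show ?thesis
          using that by (simp add: mem)
      qed
      then have "measure S (E \<inter> ?G) = measure S E * measure S ?G"
        by (rule eq[OF G])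
      then show "emeasure (uniform_measure S E) ?G = emeasure S ?G"
        using pos G by (simp add: P.emeasure_eq_measure divide_ennreal zero_less_measure_iff)
    qed (auto intro: U.finite_measure_axioms)
    then have "measure S E = measure (uniform_measure S E) E"
      by simp
    also have "\<dots> = 1"
      using pos by (simp add: measure_uniform_measure pos' P.emeasure_eq_measure)
    finally show False using \<open>measure S E \<noteq> 1\<close> by simp
  qed
qed

end

section \<open>Max-plus products as maximal path weights\<close>

lemma mp_mult_vec_nth: "mp_mult_vec P x $ i = (MAX j. P $ i $ j + x $ j)"
  by (simp add: mp_mult_vec_def)

lemma mp_mult_vec_le_iff: "mp_mult_vec P x $ i \<le> c \<longleftrightarrow> (\<forall>j. P $ i $ j + x $ j \<le> c)"
  unfolding mp_mult_vec_nth by (subst Max_le_iff) auto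

lemma le_mp_mult_vec: "P $ i $ j + x $ j \<le> mp_mult_vec P x $ i"
  using mp_mult_vec_le_iff[of P x i "mp_mult_vec P x $ i"] by simp

lemma add_Max_distrib:
  fixes a :: ereal and f :: "'i::finite \<Rightarrow> ereal"
  shows "a + (MAX j. f j) = (MAX j. a + f j)"
  using mono_Max_commute[of "(+) a" "range f"] by (simp add: mono_def add_left_mono image_image)

lemma mp_mult_vec_assoc: "mp_mult_vec (mp_mult P Q) x = mp_mult_vec P (mp_mult_vec Q x)"
proof -
  have "mp_mult_vec (mp_mult P Q) x $ i = mp_mult_vec P (mp_mult_vec Q x) $ i" for i
  proof (rule antisym)
    have "mp_mult P Q $ i $ j + x $ j \<le> mp_mult_vec P (mp_mult_vec Q x) $ i" for j
    proof -
      have "mp_mult P Q $ i $ j + x $ j = (MAX k. x $ j + (P $ i $ k + Q $ k $ j))"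
        by (simp add: mp_mult_def add.commute[of _ "x $ j"] add_Max_distrib)
      also have "\<dots> \<le> mp_mult_vec P (mp_mult_vec Q x) $ i"
      proof (subst Max_le_iff; clarsimp)
        fix k
        have "P $ i $ k + (Q $ k $ j + x $ j) \<le> P $ i $ k + mp_mult_vec Q x $ k"
          by (intro add_left_mono le_mp_mult_vec)
        also have "\<dots> \<le> mp_mult_vec P (mp_mult_vec Q x) $ i"
          by (rule le_mp_mult_vec)
        finally show "x $ j + (P $ i $ k + Q $ k $ j) \<le> mp_mult_vec P (mp_mult_vec Q x) $ i"
          by (simp add: ac_simps)
      qed
      finally show ?thesis .
    qed
    then show "mp_mult_vec (mp_mult P Q) x $ i \<le> mp_mult_vec P (mp_mult_vec Q x) $ i"
      by (simp add: mp_mult_vec_le_iff)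
    have "P $ i $ k + mp_mult_vec Q x $ k \<le> mp_mult_vec (mp_mult P Q) x $ i" for k
    proof -
      have "P $ i $ k + mp_mult_vec Q x $ k = (MAX j. P $ i $ k + (Q $ k $ j + x $ j))"
        by (simp add: mp_mult_vec_nth add_Max_distrib)
      also have "\<dots> \<le> mp_mult_vec (mp_mult P Q) x $ i"
      proof (subst Max_le_iff; clarsimp)
        fix j
        have "P $ i $ k + Q $ k $ j \<le> mp_mult P Q $ i $ j"
          by (simp add: mp_mult_def)
        then have "P $ i $ k + Q $ k $ j + x $ j \<le> mp_mult P Q $ i $ j + x $ j"
          by (rule add_right_mono)
        also have "\<dots> \<le> mp_mult_vec (mp_mult P Q) x $ i"
          by (rule le_mp_mult_vec)
        finally show "P $ i $ k + (Q $ k $ j + x $ j) \<le> mp_mult_vec (mp_mult P Q) x $ i"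
          by (simp add: ac_simps)
      qed
      finally show ?thesis .
    qed
    then show "mp_mult_vec P (mp_mult_vec Q x) $ i \<le> mp_mult_vec (mp_mult P Q) x $ i"
      by (simp add: mp_mult_vec_le_iff)
  qed
  then show ?thesis by (simp add: vec_eq_iff)
qed

lemma mp_mult_vec_id:
  assumes "\<And>j. x $ j \<noteq> \<infinity>"
  shows "mp_mult_vec mp_id x = x"
proof -
  have "mp_mult_vec mp_id x $ i = x $ i" for i
  proof (rule antisym)
    have "- \<infinity> + x $ j \<le> x $ i" for j
      using assms[of j] by (cases "x $ j") auto
    then show "mp_mult_vec mp_id x $ i \<le> x $ i"
      by (auto simp: mp_mult_vec_le_iff mp_id_def)
    show "x $ i \<le> mp_mult_vec mp_id x $ i"
      using le_mp_mult_vec[of mp_id i i x] by (simp add: mp_id_def)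
  qed
  then show ?thesis by (simp add: vec_eq_iff)
qed

lemma mp_mult_vec_finite:
  assumes "\<And>i j. P $ i $ j \<noteq> \<infinity>" "\<And>j. x $ j \<noteq> \<infinity>"
  shows "mp_mult_vec P x $ i \<noteq> \<infinity>"
proof -
  have "mp_mult_vec P x $ i \<in> range (\<lambda>j. P $ i $ j + x $ j)"
    unfolding mp_mult_vec_nth by (rule Max_in) auto
  then show ?thesis using assms by auto
qed

lemma mp_entry_max_eq: "mp_entry_max P = (MAX i. mp_mult_vec P 0 $ i)"
  by (simp add: mp_entry_max_def mp_mult_vec_nth)

text \<open>
  Entry \<open>i\<close> is the largest weight of a path of length \<open>n\<close> from \<open>i\<close>, with terminal reward \<open>x\<close>. The recursion splits
  off the first step, which matches the shift; backward products grow at the other end.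
\<close>

primrec path_values :: "nat \<Rightarrow> (nat \<Rightarrow> ereal^'n^'n) \<Rightarrow> ereal^'n \<Rightarrow> ereal^'n" where
  "path_values 0 w x = x"
| "path_values (Suc n) w x = mp_mult_vec (w 0) (path_values n (seq_shift w) x)"

text \<open>
  This is how a backward product grows: its newest factor acts on the terminal rewards.
\<close>

lemma path_values_Suc_right: "path_values (Suc n) w x = path_values n w (mp_mult_vec (w n) x)"
proof (induction n arbitrary: w)
  case (Suc n)
  from Suc[of "seq_shift w"] show ?case
    by (simp add: seq_shift_def)
qed simp

lemma path_values_cong:
  assumes "\<And>k. k < n \<Longrightarrow> w k = v k"
  shows "path_values n w x = path_values n v x"
  using assms
proof (induction n arbitrary: w v)
  case (Suc n)
  have "path_values n (seq_shift w) x = path_values n (seq_shift v) x"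
    by (rule Suc.IH) (simp add: seq_shift_def Suc.prems)
  then show ?case
    using Suc.prems[of 0] by simp
qed simp

lemma mp_backward_eq_path_values:
  assumes "\<And>n i j. A n $ i $ j \<noteq> \<infinity>" "\<And>j. x $ j \<noteq> \<infinity>"
  shows "mp_mult_vec (mp_backward A n) x = path_values n (\<lambda>k. A (- 1 - int k)) x"
  using assms(2)
proof (induction n arbitrary: x)
  case 0
  then show ?case by (simp add: mp_mult_vec_id)
next
  case (Suc n)
  have "A (- int (Suc n)) = A (- 1 - int n)" by (rule arg_cong[where f = A]) simp
  then show ?case
    using Suc.IH[OF mp_mult_vec_finite[OF assms(1) Suc.prems], of "- int (Suc n)"]
    by (simp only: mp_backward.simps path_values_Suc_right mp_mult_vec_assoc)
qed

lemma mp_forward_eq_path_values: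
  assumes "\<And>j. x $ j \<noteq> \<infinity>"
  shows "mp_mult_vec (mp_forward A n) x = path_values n (reverse_prefix n (\<lambda>k. A (int k))) x"
proof (induction n)
  case 0
  then show ?case using assms by (simp add: mp_mult_vec_id)
next
  case (Suc n)
  let ?A = "\<lambda>k. A (int k)"
  have "path_values n (seq_shift (reverse_prefix (Suc n) ?A)) x = path_values n (reverse_prefix n ?A) x"
    by (intro path_values_cong) (auto simp: seq_shift_def reverse_prefix_def)
  moreover have "reverse_prefix (Suc n) ?A 0 = A (int n)"
    by (simp add: reverse_prefix_def)
  ultimately show ?case
    using Suc by (simp add: mp_mult_vec_assoc)
qed

definition path_value :: "'n \<Rightarrow> nat \<Rightarrow> (nat \<Rightarrow> ereal^'n^'n) \<Rightarrow> ereal" where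
  "path_value i n w = path_values n w 0 $ i"

definition best_path_value :: "nat \<Rightarrow> (nat \<Rightarrow> ereal^'n^'n) \<Rightarrow> ereal" where
  "best_path_value n w = (MAX i. path_value i n w)"

lemma path_value_0: "path_value i 0 w = 0"
  by (simp add: path_value_def)

lemma best_path_value_0: "best_path_value 0 w = 0"
  by (simp add: best_path_value_def path_value_0)

lemma path_value_Suc: "path_value i (Suc n) w = (MAX j. w 0 $ i $ j + path_value j n (seq_shift w))"
  by (simp add: path_value_def mp_mult_vec_nth)

lemma path_value_Suc_le_iff:
  "path_value i (Suc n) w \<le> c \<longleftrightarrow> (\<forall>j. w 0 $ i $ j + path_value j n (seq_shift w) \<le> c)"
  by (simp add: path_value_def mp_mult_vec_le_iff)

lemma path_value_Suc_ge: "w 0 $ i $ j + path_value j n (seq_shift w) \<le> path_value i (Suc n) w"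
  by (simp add: path_value_def le_mp_mult_vec)

lemma path_value_le_best: "path_value i n w \<le> best_path_value n w"
  by (simp add: best_path_value_def)

lemma best_path_value_le_iff: "best_path_value n w \<le> c \<longleftrightarrow> (\<forall>i. path_value i n w \<le> c)"
  unfolding best_path_value_def by (subst Max_le_iff) auto

text \<open>
  A path of length \<open>n + k\<close> is a path of length \<open>n\<close> followed by one of length \<open>k\<close> from wherever the first one
  ends.
\<close>

lemma path_value_add:
  "path_value i (n + k) w \<le> path_value i n w + best_path_value k ((seq_shift ^^ n) w)"
proof (induction n arbitrary: i w)
  case 0
  then show ?case by (simp add: path_value_0 path_value_le_best)
next
  case (Suc n)
  let ?B = "best_path_value k ((seq_shift ^^ Suc n) w)"
  have "w 0 $ i $ j + path_value j (n + k) (seq_shift w) \<le> path_value i (Suc n) w + ?B" for j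
  proof -
    have "path_value j (n + k) (seq_shift w) \<le> path_value j n (seq_shift w) + ?B"
      using Suc[of j "seq_shift w"] by (simp add: funpow_swap1)
    then have "w 0 $ i $ j + path_value j (n + k) (seq_shift w) \<le>
        (w 0 $ i $ j + path_value j n (seq_shift w)) + ?B"
      unfolding add.assoc by (rule add_left_mono)
    also have "\<dots> \<le> path_value i (Suc n) w + ?B"
      by (intro add_right_mono path_value_Suc_ge)
    finally show ?thesis .
  qed
  then show ?case by (simp add: path_value_Suc_le_iff)
qed

lemma best_path_value_add:
  "best_path_value (n + k) w \<le> best_path_value n w + best_path_value k ((seq_shift ^^ n) w)"
  unfolding best_path_value_le_iff
  by (intro allI order_trans[OF path_value_add] add_right_mono path_value_le_best)

lemma best_path_value_cong:
  assumes "\<And>k. k < n \<Longrightarrow> w k = v k"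
  shows "best_path_value n w = best_path_value n v"
  unfolding best_path_value_def path_value_def using path_values_cong[of n w v 0, OF assms] by simp

text \<open>
  In the reversed sequence the newest factors come first, so the two parts exchange their places.
\<close>

lemma best_path_value_reverse_add:
  "best_path_value (n + k) (reverse_prefix (n + k) w) \<le>
    best_path_value n (reverse_prefix n w) +
    best_path_value k (reverse_prefix k ((seq_shift ^^ n) w))"
proof -
  have "best_path_value k (reverse_prefix (n + k) w) =
      best_path_value k (reverse_prefix k ((seq_shift ^^ n) w))"
    by (rule best_path_value_cong) (auto simp: reverse_prefix_def seq_shift_funpow intro!: arg_cong[where f = w])
  moreover have "best_path_value n ((seq_shift ^^ k) (reverse_prefix (n + k) w)) =
      best_path_value n (reverse_prefix n w)"
    by (rule best_path_value_cong) (auto simp: reverse_prefix_def seq_shift_funpow intro!: arg_cong[where f = w])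
  ultimately show ?thesis
    using best_path_value_add[of k n "reverse_prefix (n + k) w"] by (simp add: ac_simps)
qed

lemma best_path_value_1: "best_path_value 1 w = mp_entry_max (w 0)"
  by (simp add: best_path_value_def path_value_def mp_entry_max_eq)

lemma best_path_value_eq_backward:
  assumes "\<And>n i j. A n $ i $ j \<noteq> \<infinity>"
  shows "mp_y A n 0 $ i = path_value i n (\<lambda>k. A (- 1 - int k))"
    and "mp_entry_max (mp_backward A n) = best_path_value n (\<lambda>k. A (- 1 - int k))"
  using mp_backward_eq_path_values[of A 0 n, OF assms]
  by (simp_all add: mp_y_def path_value_def best_path_value_def mp_entry_max_eq)

text \<open>
  The forward product multiplies new factors on the left, so its first factor is the newest one.
\<close>

lemma best_path_value_eq_forward:
  "mp_entry_max (mp_forward A n) = best_path_value n (reverse_prefix n (\<lambda>k. A (int k)))"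
  using mp_forward_eq_path_values[of 0 A n]
  by (simp add: best_path_value_def path_value_def mp_entry_max_eq)

lemma path_values_finite:
  assumes "\<And>k i j. w k $ i $ j \<noteq> \<infinity>"
  shows "path_values n w 0 $ i \<noteq> \<infinity>"
  using assms
proof (induction n arbitrary: w i)
  case (Suc n)
  have "path_values n (seq_shift w) 0 $ j \<noteq> \<infinity>" for j
    using Suc.prems by (intro Suc.IH) (simp add: seq_shift_def)
  then show ?case
    using Suc.prems by (simp add: mp_mult_vec_finite)
qed simp

lemma best_path_value_finite:
  assumes "\<And>k i j. w k $ i $ j \<noteq> \<infinity>"
  shows "best_path_value n w \<noteq> \<infinity>"
proof -
  have "best_path_value n w \<in> range (\<lambda>i. path_value i n w)"
    unfolding best_path_value_def by (rule Max_in) auto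
  then obtain i where "best_path_value n w = path_value i n w"
    by auto
  then show ?thesis
    using path_values_finite[of w n i, OF assms] by (simp add: path_value_def)
qed

section \<open>Growth of products of independent matrices\<close>

text \<open>
  Equality of the laws for each fixed \<open>n\<close> suffices: otherwise a level \<open>c\<close> strictly between the limits would be
  exceeded with probability tending to one by \<open>X n\<close> and to zero by \<open>Z n\<close>.
\<close>

lemma (in prob_space) limit_le_if_same_law:
  fixes X Z :: "nat \<Rightarrow> 'a \<Rightarrow> ereal"
  assumes [measurable]: "\<And>n. X n \<in> borel_measurable M" "\<And>n. Z n \<in> borel_measurable M"
    and law: "\<And>n. distr M borel (X n) = distr M borel (Z n)"
    and X: "AE w in M. (\<lambda>n. X n w) \<longlonglongrightarrow> x" and Z: "AE w in M. (\<lambda>n. Z n w) \<longlonglongrightarrow> z"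
  shows "x \<le> z"
proof (rule ccontr)
  assume "\<not> x \<le> z"
  then obtain c where c: "z < c" "c < x"
    using ereal_dense2 by (meson not_le)
  let ?f = "indicator {c<..} :: ereal \<Rightarrow> real"
  have "(\<lambda>n. \<integral>w. ?f (X n w) \<partial>M) \<longlonglongrightarrow> (\<integral>w. 1 \<partial>M)"
  proof (rule integral_dominated_convergence[where w = "\<lambda>_. 1"])
    show "AE w in M. (\<lambda>n. ?f (X n w)) \<longlonglongrightarrow> 1"
      using X
    proof eventually_elim
      case (elim w)
      from order_tendstoD(1)[OF this c(2)] show ?case
        by (intro tendsto_eventually) (auto elim: eventually_mono)
    qed
  qed auto
  moreover have "(\<lambda>n. \<integral>w. ?f (Z n w) \<partial>M) \<longlonglongrightarrow> (\<integral>w. 0 \<partial>M)"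
  proof (rule integral_dominated_convergence[where w = "\<lambda>_. 1"])
    show "AE w in M. (\<lambda>n. ?f (Z n w)) \<longlonglongrightarrow> 0"
      using Z
    proof eventually_elim
      case (elim w)
      from order_tendstoD(2)[OF this c(1)] show ?case
        by (intro tendsto_eventually) (auto elim: eventually_mono)
    qed
  qed auto
  moreover have "(\<integral>w. ?f (X n w) \<partial>M) = (\<integral>w. ?f (Z n w) \<partial>M)" for n
    using integral_distr[of "X n" M borel ?f] integral_distr[of "Z n" M borel ?f] law[of n] by simp
  ultimately have "(\<integral>w. 1 \<partial>M) = (\<integral>w. 0 \<partial>M :: real)"
    using LIMSEQ_unique by auto
  then show False by (simp add: prob_space)
qed

locale iid_matrices = sequence_space M for M :: "(ereal^'d^'d) measure" +
  assumes sets_M [measurable_cong]: "sets M = sets borel"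
    and positive_part_integrable: "integrable M (\<lambda>m. real_of_ereal (max 0 (mp_entry_max m)))"
    and entries_not_PInf: "AE m in M. \<forall>i j. m $ i $ j \<noteq> \<infinity>"
begin

lemma entry_measurable [measurable]: "(\<lambda>m. m $ i $ j) \<in> borel_measurable M"
proof -
  have "continuous_on UNIV (\<lambda>m::ereal^'d^'d. m $ i $ j)"
    by (intro continuous_on_component continuous_on_id)
  then show ?thesis
    using borel_measurable_continuous_onI measurable_cong_sets[OF sets_M refl] by blast
qed

lemma path_value_measurable [measurable]: "path_value i n \<in> borel_measurable S"
proof (induction n arbitrary: i)
  case 0
  then show ?case by (simp add: path_value_0[abs_def])
next
  case (Suc n)
  note [measurable] = Suc measure_preserving_map.T_measurable[OF measure_preserving_seq_shift]
  have "path_value i (Suc n) = (\<lambda>w. MAX j. w 0 $ i $ j + path_value j n (seq_shift w))"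
    by (simp add: fun_eq_iff path_value_Suc)
  also have "\<dots> \<in> borel_measurable S"
    by measurable
  finally show ?case .
qed

lemma best_path_value_measurable [measurable]: "best_path_value n \<in> borel_measurable S"
  unfolding best_path_value_def[abs_def] by measurable

definition head_weight :: "(nat \<Rightarrow> ereal^'d^'d) \<Rightarrow> real" where
  "head_weight w = real_of_ereal (max 0 (mp_entry_max (w 0)))"

lemma AE_entries_not_PInf: "AE w in S. \<forall>k i j. w k $ i $ j \<noteq> \<infinity>"
  unfolding AE_all_countable using entries_not_PInf
  by (intro allI AE_component) auto

lemma head_measurable: "(\<lambda>w. w 0) \<in> measurable S M"
  by (rule measurable_component_singleton) simp

lemma distr_head: "distr S M (\<lambda>w. w 0) = M"
  by (rule PiM_component) simp

lemma head_weight_integrable: "integrable S head_weight"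
  unfolding head_weight_def[abs_def]
  by (rule integrable_distr[OF head_measurable, unfolded distr_head, OF positive_part_integrable])

lemma best_path_value_1_le: "AE w in S. best_path_value 1 w \<le> ereal (head_weight w)"
  using AE_entries_not_PInf
proof eventually_elim
  case (elim w)
  then have "best_path_value 1 w \<noteq> \<infinity>"
    by (intro best_path_value_finite) auto
  then show ?case
    unfolding best_path_value_1 head_weight_def
    by (cases "mp_entry_max (w 0)") (auto simp: max_def)
qed

lemma head_weight_nonneg: "0 \<le> head_weight w"
  unfolding head_weight_def by (intro real_of_ereal_pos) simp

sublocale backward: subadditive_family S seq_shift path_value head_weight
proof (intro subadditive_family.intro subadditive_family_axioms.intro)
  show "path_value i (n + k) w \<le> path_value i n w + (MAX j. path_value j k ((seq_shift ^^ n) w))" for i n k w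
    using path_value_add[of i n k w] unfolding best_path_value_def .
  show "AE w in S. \<forall>i. path_value i 1 w \<le> ereal (head_weight w)"
    using best_path_value_1_le by (simp add: best_path_value_le_iff)
qed (simp_all add: measure_preserving_seq_shift path_value_0 head_weight_integrable head_weight_nonneg)

text \<open>
  The largest entry of the forward product, as a family over the one-point type.
\<close>

definition forward_value :: "unit \<Rightarrow> nat \<Rightarrow> (nat \<Rightarrow> ereal^'d^'d) \<Rightarrow> ereal" where
  "forward_value _ n w = best_path_value n (reverse_prefix n w)"

lemma forward_value_measurable [measurable]: "forward_value u n \<in> borel_measurable S"
  unfolding forward_value_def[abs_def]
  by (rule measurable_compose[OF reverse_prefix_measurable best_path_value_measurable])

lemma forward_value_add:
  "forward_value u (n + k) w \<le> forward_value u n w + forward_value u' k ((seq_shift ^^ n) w)"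
  using best_path_value_reverse_add[of n k w] unfolding forward_value_def .

sublocale forward: subadditive_family S seq_shift forward_value head_weight
proof (intro subadditive_family.intro subadditive_family_axioms.intro)
  show "forward_value u (n + k) w \<le> forward_value u n w + (MAX v. forward_value v k ((seq_shift ^^ n) w))" for u n k w
    using forward_value_add[of u n k w] by (simp add: UNIV_unit)
  have "reverse_prefix 1 w = w" for w :: "nat \<Rightarrow> ereal^'d^'d"
    by (auto simp: reverse_prefix_def fun_eq_iff)
  then show "AE w in S. \<forall>u. forward_value u 1 w \<le> ereal (head_weight w)"
    using best_path_value_1_le unfolding forward_value_def by simp
qed (simp_all add: measure_preserving_seq_shift forward_value_def best_path_value_0 head_weight_integrable head_weight_nonneg)

text \<open>
  Deleting a prefix can only increase the lower rate, as the deleted factors contribute at most a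
  finite amount. So a prefix never raises the probability that the lower rate exceeds \<open>c\<close>, and the zero-one
  law applies.
\<close>

lemma forward_dichotomy:
  fixes c :: real
  shows "(AE w in S. \<forall>u. liminf (slope (\<lambda>n. forward_value u n w)) \<le> ereal c) \<or>
    (AE w in S. \<forall>u. ereal c \<le> liminf (slope (\<lambda>n. forward_value u n w)))"
proof -
  define L where "L w = liminf (slope (\<lambda>n. forward_value () n w))" for w
  have [measurable]: "L \<in> borel_measurable S"
    unfolding L_def[abs_def] by measurable
  define E where "E = {w\<in>space S. ereal c < L w}"
  have E[measurable]: "E \<in> sets S"
    unfolding E_def by measurable
  have "measure S E = 0 \<or> measure S E = 1"
  proof (rule zero_one_if_prefix_irrelevant[OF E])
    fix t
    show "AE w in S. measure S {v\<in>space S. comb_seq t w v \<in> E} \<le> measure S E"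
      using AE_entries_not_PInf
    proof eventually_elim
      case (elim w)
      have "forward_value () t w \<noteq> \<infinity>"
        unfolding forward_value_def using elim
        by (intro best_path_value_finite) (auto simp: reverse_prefix_def)
      then obtain D where D: "forward_value () t w \<le> ereal D"
        by (cases "forward_value () t w") auto
      have "L (comb_seq t w v) \<le> L v" for v
        unfolding L_def
      proof (rule liminf_slope_shift_le)
        fix n
        have prefix: "forward_value () t (comb_seq t w v) = forward_value () t w"
          unfolding forward_value_def
          by (rule best_path_value_cong) (simp add: reverse_prefix_def comb_seq_def)
        have suffix: "(seq_shift ^^ t) (comb_seq t w v) = v"
          by (simp add: seq_shift_funpow comb_seq_def)
        have "forward_value () (t + n) (comb_seq t w v) \<le> ereal D + forward_value () n v"
          using forward_value_add[of "()" t n "comb_seq t w v" "()"] add_right_mono[OF D]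
          unfolding prefix suffix by (rule order_trans)
        then show "ereal (- D) + forward_value () (t + n) (comb_seq t w v) \<le> forward_value () (0 + n) v"
          by (cases "forward_value () n v"; cases "forward_value () (t + n) (comb_seq t w v)") auto
      qed
      then show ?case
        by (intro P.finite_measure_mono E) (auto simp: E_def intro: less_le_trans)
    qed
  qed
  then show ?thesis
  proof
    assume "measure S E = 0"
    then have "AE w in S. w \<notin> E"
      by (intro AE_not_in) (simp add: null_sets_def P.emeasure_eq_measure)
    then have "AE w in S. L w \<le> ereal c"
      using AE_space by eventually_elim (auto simp: E_def)
    then show ?thesis by (simp add: L_def)
  next
    assume "measure S E = 1"
    then have "AE w in S. w \<in> E"
      by (simp add: P.prob_eq_1)
    then have "AE w in S. ereal c \<le> L w"
      by eventually_elim (auto simp: E_def)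
    then show ?thesis by (simp add: L_def)
  qed
qed

definition lower_slope :: "'d \<Rightarrow> (nat \<Rightarrow> ereal^'d^'d) \<Rightarrow> ereal" where
  "lower_slope i w = liminf (slope (\<lambda>n. path_value i n w))"

lemma lower_slope_measurable [measurable]: "lower_slope i \<in> borel_measurable S"
  unfolding lower_slope_def[abs_def] by measurable

text \<open>
  Start with the finite arc from \<open>i\<close> to \<open>j\<close>, then continue optimally from \<open>j\<close>.
\<close>

lemma lower_slope_step:
  assumes "w 0 $ i $ j \<noteq> -\<infinity>"
  shows "lower_slope j (seq_shift w) \<le> lower_slope i w"
proof -
  obtain C where C: "ereal C \<le> w 0 $ i $ j"
    using assms by (cases "w 0 $ i $ j") auto
  have "ereal C + path_value j (0 + n) (seq_shift w) \<le> path_value i (1 + n) w" for n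
    using add_right_mono[OF C] path_value_Suc_ge[of w i j n] by (auto intro: order_trans)
  then show ?thesis
    unfolding lower_slope_def by (rule liminf_slope_shift_le)
qed

text \<open>
  Rows with finite entries allow a path from \<open>i\<close> to survive any prefix; it arrives at a state \<open>j\<close>
  that depends on the prefix only, so the bound holds for all continuations \<open>v\<close> at once.
\<close>

lemma lower_slope_comb_seq:
  assumes "\<And>k i. \<exists>j. w k $ i $ j \<noteq> -\<infinity>"
  shows "\<exists>j. \<forall>v. lower_slope j v \<le> lower_slope i (comb_seq t w v)"
  using assms
proof (induction t arbitrary: w i)
  case 0
  then show ?case by (auto simp: comb_seq_0)
next
  case (Suc t)
  obtain j where j: "w 0 $ i $ j \<noteq> -\<infinity>"
    using Suc.prems by blast
  have "\<exists>j'. \<forall>v. lower_slope j' v \<le> lower_slope j (comb_seq t (seq_shift w) v)"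
    using Suc.prems by (intro Suc.IH) (simp add: seq_shift_def)
  then obtain j' where j': "\<And>v. lower_slope j' v \<le> lower_slope j (comb_seq t (seq_shift w) v)"
    by blast
  have "lower_slope j (comb_seq t (seq_shift w) v) \<le> lower_slope i (comb_seq (Suc t) w v)" for v
    using lower_slope_step[of "comb_seq (Suc t) w v" i j] j
    by (simp add: seq_shift_comb_seq comb_seq_less del: comb_seq_Suc_0)
  with j' show ?case
    by (meson order_trans)
qed

text \<open>
  Fix one first matrix for which the arc is finite. As the shifted sequence is independent of the first
  matrix and has the original law, \<open>lower_slope_step\<close> carries the bound from \<open>i\<close> over to \<open>j\<close>.
\<close>

lemma AE_lower_slope_le_arc:
  assumes "AE w in S. lower_slope i w \<le> ereal c"
    and arc: "measure M {m\<in>space M. m $ i $ j \<noteq> -\<infinity>} > 0"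
  shows "AE w in S. lower_slope j w \<le> ereal c"
proof (rule ccontr)
  assume not: "\<not> (AE w in S. lower_slope j w \<le> ereal c)"
  have "AE w in S. w 0 $ i $ j = -\<infinity>"
    using AE_comb_seq[OF assms(1), of 1]
  proof eventually_elim
    case (elim w)
    show ?case
    proof (rule ccontr)
      assume "w 0 $ i $ j \<noteq> -\<infinity>"
      then have "lower_slope j v \<le> lower_slope i (comb_seq (Suc 0) w v)" for v
        using lower_slope_step[of "comb_seq (Suc 0) w v" i j]
        by (simp add: seq_shift_comb_seq comb_seq_0 comb_seq_less del: comb_seq_Suc_0)
      with elim have "AE v in S. lower_slope j v \<le> ereal c"
        unfolding One_nat_def by (elim eventually_mono) (rule order_trans)
      with not show False by blast
    qed
  qed
  then have "AE m in M. m $ i $ j = -\<infinity>"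
    by (subst (asm) AE_distr_iff[OF head_measurable, unfolded distr_head, symmetric]) auto
  then have "measure M {m\<in>space M. m $ i $ j \<noteq> -\<infinity>} = 0"
    by (intro measure_eq_0_null_sets AE_iff_null[THEN iffD1]) auto
  with arc show False by simp
qed

text \<open>
  A maximum principle. For the index that maximises the probability of a lower rate at most \<open>c\<close>, a prefix
  cannot raise this probability: it only replaces the index by another one. The zero-one law then leaves two
  cases. If the largest probability vanishes, they all do; if it is one, strong connectivity spreads
  it to all indices.
\<close>

lemma backward_dichotomy:
  fixes c :: real
  assumes rows: "AE m in M. \<forall>i. \<exists>j. m $ i $ j \<noteq> -\<infinity>"
    and connected: "\<And>i j. (i, j) \<in> {(i, j). measure M {m\<in>space M. m $ i $ j \<noteq> -\<infinity>} > 0}\<^sup>*"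
  shows "(AE w in S. \<forall>i. liminf (slope (\<lambda>n. path_value i n w)) \<le> ereal c) \<or>
    (AE w in S. \<forall>i. ereal c \<le> liminf (slope (\<lambda>n. path_value i n w)))"
proof -
  define E where "E i = {w\<in>space S. lower_slope i w \<le> ereal c}" for i
  have E[measurable]: "E i \<in> sets S" for i
    unfolding E_def by measurable
  have AE_rows: "AE w in S. \<forall>k i. \<exists>j. w k $ i $ j \<noteq> -\<infinity>"
  proof (rule AE_all_countable[THEN iffD2], rule allI)
    show "AE w in S. \<forall>i. \<exists>j. w k $ i $ j \<noteq> -\<infinity>" for k
      by (rule AE_component[OF _ rows]) simp
  qed
  have "Max (range (\<lambda>i. measure S (E i))) \<in> range (\<lambda>i. measure S (E i))"
    by (rule Max_in) auto
  then obtain i0 where "Max (range (\<lambda>i. measure S (E i))) = measure S (E i0)"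
    by (rule rangeE)
  then have i0: "measure S (E i) \<le> measure S (E i0)" for i
    by (metis Max_ge finite finite_imageI rangeI)
  have "measure S (E i0) = 0 \<or> measure S (E i0) = 1"
  proof (rule zero_one_if_prefix_irrelevant[OF E])
    fix t
    show "AE w in S. measure S {v\<in>space S. comb_seq t w v \<in> E i0} \<le> measure S (E i0)"
      using AE_rows
    proof eventually_elim
      case (elim w)
      then obtain j where j: "\<And>v. lower_slope j v \<le> lower_slope i0 (comb_seq t w v)"
        using lower_slope_comb_seq[of w i0 t] by blast
      have "measure S {v\<in>space S. comb_seq t w v \<in> E i0} \<le> measure S (E j)"
        by (intro P.finite_measure_mono E) (auto simp: E_def intro: order_trans[OF j])
      also note i0
      finally show ?case .
    qed
  qed
  then show ?thesis
  proof
    assume "measure S (E i0) = 0"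
    then have "measure S (E i) = 0" for i
      using i0[of i] measure_nonneg[of S "E i"] by simp
    then have "AE w in S. w \<notin> E i" for i
      by (intro AE_not_in) (simp add: null_sets_def P.emeasure_eq_measure)
    then have "AE w in S. \<forall>i. w \<notin> E i"
      by (simp add: AE_all_countable)
    then have "AE w in S. \<forall>i. ereal c \<le> lower_slope i w"
      using AE_space by eventually_elim (auto simp: E_def not_le intro: less_imp_le)
    then show ?thesis by (simp add: lower_slope_def)
  next
    assume "measure S (E i0) = 1"
    then have "AE w in S. w \<in> E i0"
      by (simp add: P.prob_eq_1)
    then have start: "AE w in S. lower_slope i0 w \<le> ereal c"
      by eventually_elim (simp add: E_def)
    have "AE w in S. lower_slope i w \<le> ereal c" for i
      using connected[of i0 i]
    proof (induction rule: rtrancl_induct)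
      case (step j k)
      then show ?case using AE_lower_slope_le_arc by auto
    qed (rule start)
    then have "AE w in S. \<forall>i. lower_slope i w \<le> ereal c"
      by (simp add: AE_all_countable)
    then show ?thesis by (simp add: lower_slope_def)
  qed
qed

text \<open>
  The zero-one laws yield one constant for the backward and one for the forward products. They agree since
  \<open>reverse_prefix\<close> preserves the law.
\<close>

lemma common_growth_rate:
  assumes rows: "AE m in M. \<forall>i. \<exists>j. m $ i $ j \<noteq> -\<infinity>"
    and connected: "\<And>i j. (i, j) \<in> {(i, j). measure M {m\<in>space M. m $ i $ j \<noteq> -\<infinity>} > 0}\<^sup>*"
  shows "\<exists>\<gamma>. \<gamma> \<noteq> \<infinity> \<and>
    (AE w in S. \<forall>i. slope (\<lambda>n. path_value i n w) \<longlonglongrightarrow> \<gamma>) \<and>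
    (AE w in S. slope (\<lambda>n. best_path_value n w) \<longlonglongrightarrow> \<gamma>) \<and>
    (AE w in S. slope (\<lambda>n. best_path_value n (reverse_prefix n w)) \<longlonglongrightarrow> \<gamma>)"
proof -
  have best: "backward.Y_max = best_path_value"
    by (simp add: backward.Y_max_def best_path_value_def fun_eq_iff)
  obtain \<gamma> where \<gamma>: "\<gamma> \<noteq> \<infinity>"
    and bwd: "AE w in S. (\<forall>i. slope (\<lambda>n. path_value i n w) \<longlonglongrightarrow> \<gamma>) \<and>
      slope (\<lambda>n. best_path_value n w) \<longlonglongrightarrow> \<gamma>"
    using backward.convergence_if_dichotomy[OF backward_dichotomy[OF assms]] unfolding best by blast
  obtain \<gamma>' where fwd: "AE w in S. \<forall>u. slope (\<lambda>n. forward_value u n w) \<longlonglongrightarrow> \<gamma>'"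
    using forward.convergence_if_dichotomy[OF forward_dichotomy] by auto
  define X where "X n w = slope (\<lambda>n. best_path_value n w) n" for n and w :: "nat \<Rightarrow> ereal^'d^'d"
  define Z where "Z n w = slope (\<lambda>n. forward_value () n w) n" for n w
  have [measurable]: "X n \<in> borel_measurable S" "Z n \<in> borel_measurable S" for n
    unfolding X_def[abs_def] Z_def[abs_def] by measurable
  have X: "AE w in S. (\<lambda>n. X n w) \<longlonglongrightarrow> \<gamma>"
    using bwd by eventually_elim (simp add: X_def)
  have Z: "AE w in S. (\<lambda>n. Z n w) \<longlonglongrightarrow> \<gamma>'"
    using fwd by eventually_elim (simp add: Z_def)
  have law: "distr S borel (Z n) = distr S borel (X n)" for n
  proof -
    have "Z n = X n \<circ> reverse_prefix n"
      by (simp add: fun_eq_iff X_def Z_def slope_def forward_value_def)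
    then have "distr S borel (Z n) = distr (distr S S (reverse_prefix n)) borel (X n)"
      by (simp add: distr_distr[OF _ reverse_prefix_measurable])
    then show ?thesis by (simp only: distr_reverse_prefix)
  qed
  have "\<gamma>' = \<gamma>"
    using P.limit_le_if_same_law[of X Z, OF _ _ law[symmetric] X Z]
      P.limit_le_if_same_law[of Z X, OF _ _ law Z X] by simp
  have "AE w in S. \<forall>i. slope (\<lambda>n. path_value i n w) \<longlonglongrightarrow> \<gamma>"
    using bwd by (rule eventually_mono) simp
  moreover have "AE w in S. slope (\<lambda>n. best_path_value n w) \<longlonglongrightarrow> \<gamma>"
    using bwd by (rule eventually_mono) simp
  moreover have "AE w in S. slope (\<lambda>n. best_path_value n (reverse_prefix n w)) \<longlonglongrightarrow> \<gamma>"
    using fwd unfolding \<open>\<gamma>' = \<gamma>\<close> forward_value_def by simp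
  ultimately show ?thesis
    using \<gamma> by blast
qed

end

section \<open>The maximal Lyapunov exponent\<close>

text \<open>
  Along every injective choice of times the matrices form a sequence with the product law. The choices
  \<open>k \<mapsto> -1-k\<close> and \<open>k \<mapsto> k\<close> lead to the two products in the definition of the Lyapunov exponent.
\<close>

lemma iid_sequence_law:
  fixes M :: "'w measure" and A :: "int \<Rightarrow> 'w \<Rightarrow> ereal^'d^'d"
  assumes "prob_space M" and iid: "iid_random_matrices M A" and f: "inj (f :: nat \<Rightarrow> int)"
  shows "(\<lambda>x k. A (f k) x) \<in> measurable M (\<Pi>\<^sub>M k\<in>UNIV. distr M borel (A 0))"
    and "distr M (\<Pi>\<^sub>M k\<in>UNIV. distr M borel (A 0)) (\<lambda>x k. A (f k) x) =
      (\<Pi>\<^sub>M k\<in>UNIV. distr M borel (A 0))"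
proof -
  interpret prob_space M by fact
  have indep: "indep_vars (\<lambda>_. borel) A UNIV" and law: "\<And>n. distr M borel (A n) = distr M borel (A 0)"
    using iid by (auto simp: iid_random_matrices_def)
  have A[measurable]: "A n \<in> measurable M borel" for n
    using indep by (simp add: indep_vars_def)
  let ?\<mu> = "distr M borel (A 0)"
  interpret \<mu>: prob_space ?\<mu>
    by (rule prob_space_distr) simp
  have sets: "sets (Pi\<^sub>M (UNIV :: int set) (\<lambda>_. ?\<mu>)) = sets (Pi\<^sub>M UNIV (\<lambda>_. borel))"
    by (intro sets_PiM_cong) auto
  have "(\<lambda>x n. A n x) \<in> measurable M (\<Pi>\<^sub>M n\<in>UNIV. borel)"
    by (intro measurable_PiM_single') auto
  then have all: "(\<lambda>x n. A n x) \<in> measurable M (\<Pi>\<^sub>M n\<in>UNIV. ?\<mu>)"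
    by (simp add: measurable_cong_sets[OF refl sets])
  have "distr M (\<Pi>\<^sub>M n\<in>UNIV. borel) (\<lambda>x n. A n x) = (\<Pi>\<^sub>M n\<in>UNIV. distr M borel (A n))"
    using indep by (subst (asm) indep_vars_iff_distr_eq_PiM) (auto simp: restrict_UNIV)
  also have "\<dots> = (\<Pi>\<^sub>M n\<in>UNIV. ?\<mu>)"
    by (intro PiM_cong refl law)
  finally have joint: "distr M (\<Pi>\<^sub>M n\<in>UNIV. ?\<mu>) (\<lambda>x n. A n x) = (\<Pi>\<^sub>M n\<in>UNIV. ?\<mu>)"
    by (subst distr_cong[OF refl sets refl])
  have sel: "(\<lambda>w k. w (f k)) \<in> measurable (\<Pi>\<^sub>M n\<in>UNIV. ?\<mu>) (\<Pi>\<^sub>M k\<in>UNIV. ?\<mu>)"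
    by (intro measurable_PiM_single') (auto simp: space_PiM PiE_iff)
  have comp: "(\<lambda>x k. A (f k) x) = (\<lambda>w k. w (f k)) \<circ> (\<lambda>x n. A n x)"
    by (simp add: fun_eq_iff)
  show "(\<lambda>x k. A (f k) x) \<in> measurable M (\<Pi>\<^sub>M k\<in>UNIV. ?\<mu>)"
    unfolding comp by (rule measurable_comp[OF all sel])
  have "distr M (\<Pi>\<^sub>M k\<in>UNIV. ?\<mu>) (\<lambda>x k. A (f k) x) =
      distr (\<Pi>\<^sub>M n\<in>UNIV. ?\<mu>) (\<Pi>\<^sub>M k\<in>UNIV. ?\<mu>) (\<lambda>w k. w (f k))"
    unfolding comp distr_distr[OF sel all, symmetric] joint ..
  also have "\<dots> = (\<Pi>\<^sub>M k\<in>UNIV. ?\<mu>)"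
    using distr_PiM_reindex[of UNIV "\<lambda>_. ?\<mu>" f UNIV] f \<mu>.prob_space_axioms by (simp add: restrict_UNIV)
  finally show "distr M (\<Pi>\<^sub>M k\<in>UNIV. ?\<mu>) (\<lambda>x k. A (f k) x) = (\<Pi>\<^sub>M k\<in>UNIV. ?\<mu>)" .
qed

theorem theorem3p11:
  fixes M :: "'w measure" and A :: "int \<Rightarrow> 'w \<Rightarrow> ereal^'d^'d"
  assumes "prob_space M"
    and "iid_random_matrices M A"
    and "\<And>n \<omega> i j. \<omega> \<in> space M \<Longrightarrow> A n \<omega> $ i $ j \<noteq> \<infinity>"
    and "integrable M (\<lambda>\<omega>. real_of_ereal (max 0 (mp_entry_max (A 0 \<omega>))))"
    and "AE \<omega> in M. \<forall>i. \<exists>j. A 0 \<omega> $ i $ j \<noteq> -\<infinity>"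
    and "strongly_connected (mp_graph M A)"
  shows "\<forall>i. AE \<omega> in M.
           (\<lambda>n. ereal (1 / real n) * mp_y (\<lambda>k. A k \<omega>) n 0 $ i)
             \<longlonglongrightarrow> max_lyapunov_exponent M A"
proof -
  interpret prob_space M by fact
  define \<mu> where "\<mu> = distr M borel (A 0)"
  have A[measurable]: "A n \<in> measurable M borel" for n
    using assms(2) by (auto simp: iid_random_matrices_def indep_vars_def)
  interpret \<mu>: prob_space \<mu>
    unfolding \<mu>_def by (rule prob_space_distr) simp
  have entry[measurable]: "(\<lambda>m::ereal^'d^'d. m $ i $ j) \<in> borel_measurable borel" for i j
    by (intro borel_measurable_continuous_onI continuous_on_component continuous_on_id)
  have max[measurable]: "(mp_entry_max :: ereal^'d^'d \<Rightarrow> ereal) \<in> borel_measurable borel"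
    unfolding mp_entry_max_def[abs_def] by measurable
  interpret iid_matrices \<mu>
  proof
    show "sets \<mu> = sets borel" by (simp add: \<mu>_def)
    show "integrable \<mu> (\<lambda>m. real_of_ereal (max 0 (mp_entry_max m)))"
      unfolding \<mu>_def using assms(4) by (subst integrable_distr_eq) auto
    show "AE m in \<mu>. \<forall>i j. m $ i $ j \<noteq> \<infinity>"
      unfolding \<mu>_def using assms(3) by (subst AE_distr_iff) auto
  qed
  have rows: "AE m in \<mu>. \<forall>i. \<exists>j. m $ i $ j \<noteq> -\<infinity>"
    unfolding \<mu>_def using assms(5) by (subst AE_distr_iff) auto
  let ?R = "{(i, j). measure \<mu> {m\<in>space \<mu>. m $ i $ j \<noteq> -\<infinity>} > 0}"
  have "measure \<mu> {m\<in>space \<mu>. m $ i $ j \<noteq> -\<infinity>} =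
      measure M {\<omega>\<in>space M. A 0 \<omega> $ i $ j \<noteq> -\<infinity>}" for i j
    unfolding \<mu>_def by (subst measure_distr) (auto intro!: arg_cong[where f = "measure M"])
  then have "arcs_ends (mp_graph M A) = ?R"
    by (auto simp: mp_graph_def arcs_ends_def arc_to_ends_def)
  then have connected: "(i, j) \<in> ?R\<^sup>*" for i j
    using assms(6) rtrancl_on_rtranclI[of i j UNIV ?R]
    by (auto simp: strongly_connected_def reachable_def mp_graph_def)
  obtain \<gamma> where \<gamma>: "\<gamma> \<noteq> \<infinity>"
    and paths: "AE w in S. \<forall>i. slope (\<lambda>n. path_value i n w) \<longlonglongrightarrow> \<gamma>"
    and bwd: "AE w in S. slope (\<lambda>n. best_path_value n w) \<longlonglongrightarrow> \<gamma>"
    and fwd: "AE w in S. slope (\<lambda>n. best_path_value n (reverse_prefix n w)) \<longlonglongrightarrow> \<gamma>"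
    using common_growth_rate[OF rows connected] by blast
  have transfer: "AE \<omega> in M. Q (\<lambda>k. A (f k) \<omega>)" if "inj f" "AE w in S. Q w"
    for f :: "nat \<Rightarrow> int" and Q
    using AE_distrD[OF iid_sequence_law(1)[OF assms(1,2) \<open>inj f\<close>], of Q] that(2)
    unfolding iid_sequence_law(2)[OF assms(1,2) \<open>inj f\<close>] \<mu>_def by blast
  have inj: "inj (\<lambda>k. - 1 - int k)" "inj int"
    by (auto intro: injI)
  have limit_y: "AE \<omega> in M. \<forall>i. (\<lambda>n. ereal (1 / real n) * mp_y (\<lambda>k. A k \<omega>) n 0 $ i) \<longlonglongrightarrow> \<gamma>"
    using transfer[OF inj(1) paths] AE_space
    by eventually_elim (simp add: best_path_value_eq_backward assms(3) slope_def[abs_def])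
  have limit_back: "AE \<omega> in M. (\<lambda>n. ereal (1 / real n) * mp_entry_max (mp_backward (\<lambda>k. A k \<omega>) n)) \<longlonglongrightarrow> \<gamma>"
    using transfer[OF inj(1) bwd] AE_space
    by eventually_elim (simp add: best_path_value_eq_backward assms(3) slope_def[abs_def])
  have limit_forw: "AE \<omega> in M. (\<lambda>n. ereal (1 / real n) * mp_entry_max (mp_forward (\<lambda>k. A k \<omega>) n)) \<longlonglongrightarrow> \<gamma>"
    using transfer[OF inj(2) fwd]
    by eventually_elim (simp add: best_path_value_eq_forward slope_def[abs_def])
  have "max_lyapunov_exponent M A = \<gamma>"
    unfolding max_lyapunov_exponent_def
  proof (rule the_equality)
    fix \<gamma>' assume "\<gamma>' \<noteq> \<infinity> \<and>
     (AE \<omega> in M. (\<lambda>n. ereal (1 / real n) * mp_entry_max (mp_forward (\<lambda>k. A k \<omega>) n)) \<longlonglongrightarrow> \<gamma>') \<and>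
     (AE \<omega> in M. (\<lambda>n. ereal (1 / real n) * mp_entry_max (mp_backward (\<lambda>k. A k \<omega>) n)) \<longlonglongrightarrow> \<gamma>')"
    then have "AE \<omega> in M. (\<lambda>n. ereal (1 / real n) * mp_entry_max (mp_forward (\<lambda>k. A k \<omega>) n)) \<longlonglongrightarrow> \<gamma>'"
      by blast
    with limit_forw have "AE \<omega> in M. \<gamma>' = \<gamma>"
      by eventually_elim (rule LIMSEQ_unique)
    then show "\<gamma>' = \<gamma>" by simp
  qed (use \<gamma> limit_forw limit_back in blast)
  then show ?thesis
    using limit_y by (simp add: AE_all_countable)
qed

end
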